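(* Let $\Gamma$ be a discrete Abelian subgroup of $SL(3,\mathbb{R})$ where all eigenvalues of each $\gamma\in\Gamma$ are positive real numbers. Then $\Gamma$ is conjugate to a subgroup of $SL(3,\mathbb{R})$ generated by either of the following. (i) For cyclic $\Gamma$, one of the generators: - type (1): $\begin{pmatrix}1&1&0\\0&1&0\\0&0&1\end{pmatrix}$; - type (2): $\begin{pmatrix}1&1&0\\0&1&1\\0&0&1\end{pmatrix}$; - type (3): $\begin{pmatrix}e^r&0&0\\0&e^s&0\\0&0&e^t\end{pmatrix}$ with $r,s,t\in\mathbb{R}$, $r+s+t=0$, $(r,s,t)\ne(0,0,0)$; - type (4): $\begin{pmatrix}e^t&1&0\\0&e^t&0\\0&0&e^{-2t}\end{pmatrix}$ with $t\in\mathbb{R}$, $t\neq0$. (ii) For $2$-generated $\Gamma$, one of the pairs of generators: - type (1): $\begin{pmatrix}1&1&0\\0&1&0\\0&0&1\end{pmatrix}$, $\begin{pmatrix}1&0&1\\0&1&0\\0&0&1\end{pmatrix}$; - type (1'): $\begin{pmatrix}1&0&0\\0&1&1\\0&0&1\end{pmatrix}$, $\begin{pmatrix}1&0&1\\0&1&0\\0&0&1\end{pmatrix}$; - type (2): $\begin{pmatrix}1&1&0\\0&1&1\\0&0&1\end{pmatrix}$, $\begin{pmatrix}1&a&b\\0&1&a\\0&0&1\end{pmatrix}$ with $a,b\in\mathbb{R}$, $b\ne a(a-1)/2$; - type (3): $\begin{pmatrix}e^r&0&0\\0&e^s&0\\0&0&e^t\end{pmatrix}$, $\begin{pmatrix}e^{r'}&0&0\\0&e^{s'}&0\\0&0&e^{t'}\end{pmatrix}$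 with $r,s,t,r',s',t'\in\mathbb{R}$, $r+s+t=r'+s'+t'=0$; - type (4): $\begin{pmatrix}e^t&1&0\\0&e^t&0\\0&0&e^{-2t}\end{pmatrix}$, $\begin{pmatrix}e^s&a&0\\0&e^s&0\\0&0&e^{-2s}\end{pmatrix}$ with $a,s,t\in\mathbb{R}$, $(s,t)\ne(0,0)$.
   Context: Conjugation is in $SL(3,\mathbb{R})$. "2-generated" means generated by two elements but not cyclic. The proposition includes the assertion that every such $\Gamma$ is either cyclic or $2$-generated.
   Formalization: Part (i) is stated for nontrivial cyclic Γ only: the trivial group {I} is discrete, Abelian and cyclic with positive eigenvalues, but no generator listed in (i) is the identity, so the claim fails for it as written. *)

theory Defs
  imports "HOL-Analysis.Analysis" "HOL-Algebra.Elementary_Groups"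
begin

definition SL3 :: "(real^3^3) monoid" where
  "SL3 = \<lparr>carrier = {A. det A = 1}, mult = (**), one = mat 1\<rparr>"

lemma group_SL3: "group SL3"
proof (rule groupI)
  fix A assume A: "A \<in> carrier SL3"
  then have "det A \<noteq> 0" by (simp add: SL3_def)
  then obtain B where B: "B ** A = mat 1"
    by (metis invertible_def invertible_det_nz)
  then have "det B * det A = 1" by (metis det_I det_mul)
  with A B show "\<exists>B\<in>carrier SL3. B \<otimes>\<^bsub>SL3\<^esub> A = \<one>\<^bsub>SL3\<^esub>"
    by (auto simp: SL3_def)
qed (auto simp: SL3_def det_mul matrix_mul_assoc)

(* The eigenvalues of a real matrix are those of its complexification, so non-real ones count. *)
definition complex_eigenvalue :: "real^'n^'n \<Rightarrow> complex \<Rightarrow> bool" where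
  "complex_eigenvalue A z \<longleftrightarrow>
     (\<exists>v. v \<noteq> 0 \<and> map_matrix complex_of_real A *v v = z *s v)"

definition positive_real_eigenvalues :: "real^'n^'n \<Rightarrow> bool" where
  "positive_real_eigenvalues A \<longleftrightarrow>
     (\<forall>z. complex_eigenvalue A z \<longrightarrow> (\<exists>r>0. z = complex_of_real r))"

definition two_generated_group :: "('a, 'b) monoid_scheme \<Rightarrow> bool" where
  "two_generated_group G \<longleftrightarrow>
     (\<exists>x\<in>carrier G. \<exists>y\<in>carrier G. subgroup_generated G {x, y} = G) \<and> \<not> cyclic_group G"

definition conjugate_in :: "('a, 'b) monoid_scheme \<Rightarrow> 'a set \<Rightarrow> 'a set \<Rightarrow> bool" where
  "conjugate_in G H K \<longleftrightarrow>
     (\<exists>g\<in>carrier G. g <#\<^bsub>G\<^esub> (H #>\<^bsub>G\<^esub> (inv\<^bsub>G\<^esub> g)) = K)"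

(* vector [vector [...], ...] lists the rows of a matrix from top to bottom. *)
inductive standard_generator :: "real^3^3 \<Rightarrow> bool" where
  type1: "standard_generator
    (vector [vector [1, 1, 0],
             vector [0, 1, 0],
             vector [0, 0, 1]])"
| type2: "standard_generator
    (vector [vector [1, 1, 0],
             vector [0, 1, 1],
             vector [0, 0, 1]])"
| type3: "\<lbrakk>r + s + t = 0; (r, s, t) \<noteq> (0, 0, 0)\<rbrakk> \<Longrightarrow> standard_generator
    (vector [vector [exp r, 0, 0],
             vector [0, exp s, 0],
             vector [0, 0, exp t]])"
| type4: "t \<noteq> 0 \<Longrightarrow> standard_generator
    (vector [vector [exp t, 1, 0],
             vector [0, exp t, 0],
             vector [0, 0, exp (- 2 * t)]])"

inductive standard_generator_pair :: "real^3^3 \<Rightarrow> real^3^3 \<Rightarrow> bool" where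
  type1: "standard_generator_pair
    (vector [vector [1, 1, 0],
             vector [0, 1, 0],
             vector [0, 0, 1]])
    (vector [vector [1, 0, 1],
             vector [0, 1, 0],
             vector [0, 0, 1]])"
| type1': "standard_generator_pair
    (vector [vector [1, 0, 0],
             vector [0, 1, 1],
             vector [0, 0, 1]])
    (vector [vector [1, 0, 1],
             vector [0, 1, 0],
             vector [0, 0, 1]])"
| type2: "b \<noteq> a * (a - 1) / 2 \<Longrightarrow> standard_generator_pair
    (vector [vector [1, 1, 0],
             vector [0, 1, 1],
             vector [0, 0, 1]])
    (vector [vector [1, a, b],
             vector [0, 1, a],
             vector [0, 0, 1]])"
| type3: "\<lbrakk>r + s + t = 0; r' + s' + t' = 0\<rbrakk> \<Longrightarrow> standard_generator_pair
    (vector [vector [exp r, 0, 0],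
             vector [0, exp s, 0],
             vector [0, 0, exp t]])
    (vector [vector [exp r', 0, 0],
             vector [0, exp s', 0],
             vector [0, 0, exp t']])"
| type4: "(s, t) \<noteq> (0, 0) \<Longrightarrow> standard_generator_pair
    (vector [vector [exp t, 1, 0],
             vector [0, exp t, 0],
             vector [0, 0, exp (- 2 * t)]])
    (vector [vector [exp s, a, 0],
             vector [0, exp s, 0],
             vector [0, 0, exp (- 2 * s)]])"

end

theory Submission
  imports Defs "HOL-Computational_Algebra.Fundamental_Theorem_Algebra"
begin

text \<open>
  The family is commuting with real spectrum, so it can be triangularized simultaneously. Comparing
  the entries of commuting triangular matrices then conjugates it into one of five two-dimensional
  abelian groups: the diagonal matrices, a two-by-two Jordan block next to a scalar, and three
  groups of unipotent matrices. Each of them is the image of a continuous injective homomorphism from the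
  plane, so the preimage of \<open>\<Gamma>\<close> is a discrete subgroup of the plane, hence generated by one vector
  or by two linearly independent ones. Linear independence yields the side conditions on pairs of
  generators, and within each of the five groups an explicit conjugation reaches the normal form.
\<close>

text \<open>Reality of the spectrum permits triangularization over the reals; positivity gives the
  diagonal entries logarithms, so that multiplication becomes addition of coordinates. The target
  groups have dimension two, which is what bounds the rank of a discrete subgroup by two.

  The five groups come from coincidences among the three diagonal entries, taken as functions on the
  whole family. If no two of them agree, the family is diagonalizable; if exactly two agree, it fits
  a Jordan block beside a scalar; if all agree, determinant one and positivity force the common
  value 1. In that unipotent case commuting says only that the superdiagonal pairs (x, z) of any two
  members are parallel. Either some member has both entries nonzero, or all z vanish, or all x
  vanish, which gives the three unipotent groups.

  The obstacle is that no single member need separate all the eigenvalues, so one cannot diagonalize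
  one matrix and pass to its centralizer. Instead, proportionality constants are found that hold for
  the entire family.\<close>

abbreviation mat3 :: "'a \<Rightarrow> 'a \<Rightarrow> 'a \<Rightarrow> 'a \<Rightarrow> 'a \<Rightarrow> 'a \<Rightarrow> 'a \<Rightarrow> 'a \<Rightarrow> 'a \<Rightarrow> 'a::zero^3^3" where
  "mat3 a b c d e f g h i \<equiv> vector [vector [a, b, c], vector [d, e, f], vector [g, h, i]]"

lemma matrix3_eq_iff:
  fixes A B :: "'a^3^3"
  shows "A = B \<longleftrightarrow> A$1$1 = B$1$1 \<and> A$1$2 = B$1$2 \<and> A$1$3 = B$1$3
    \<and> A$2$1 = B$2$1 \<and> A$2$2 = B$2$2 \<and> A$2$3 = B$2$3
    \<and> A$3$1 = B$3$1 \<and> A$3$2 = B$3$2 \<and> A$3$3 = B$3$3"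
  by (auto simp: vec_eq_iff forall_3)

lemma mat3_mult:
  "mat3 a b c d e f g h i ** mat3 a' b' c' d' e' f' g' h' i' =
     mat3 (a*a' + b*d' + c*g') (a*b' + b*e' + c*h') (a*c' + b*f' + c*i')
          (d*a' + e*d' + f*g') (d*b' + e*e' + f*h') (d*c' + e*f' + f*i')
          (g*a' + h*d' + i*g') (g*b' + h*e' + i*h') (g*c' + h*f' + i*i')"
  for a :: "'a::comm_semiring_1"
  by (simp add: matrix3_eq_iff matrix_matrix_mult_def sum_3)

lemma mat3_eq_iff:
  "mat3 a b c d e f g h i = mat3 a' b' c' d' e' f' g' h' i' \<longleftrightarrow>
     a = a' \<and> b = b' \<and> c = c' \<and> d = d' \<and> e = e' \<and> f = f' \<and> g = g' \<and> h = h' \<and> i = i'"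
  by (auto simp: matrix3_eq_iff)

lemma det_mat3:
  "det (mat3 a b c d e f g h i) = a*e*i + b*f*g + c*d*h - a*f*h - b*d*i - c*e*g"
  by (simp add: det_3)

section \<open>Eigenvalues and the characteristic polynomial\<close>

lemma complex_eigenvalue_iff_det:
  "complex_eigenvalue A z \<longleftrightarrow> det (map_matrix complex_of_real A - mat z) = 0"
proof -
  let ?C = "map_matrix complex_of_real A"
  have "det (?C - mat z) = 0 \<longleftrightarrow> \<not> (\<forall>x. (?C - mat z) *v x = 0 \<longrightarrow> x = 0)"
    using matrix_left_invertible_ker invertible_det_nz invertible_left_inverse by metis
  moreover have "(?C - mat z) *v x = ?C *v x - z *s x" for x
    by (simp add: matrix_vector_mult_def mat_def vec_eq_iff left_diff_distrib sum_subtractf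
        if_distrib[of "\<lambda>t. t * _"] cong: if_cong)
  ultimately show ?thesis
    unfolding complex_eigenvalue_def by auto
qed

definition minors_sum :: "real^3^3 \<Rightarrow> real" where
  "minors_sum A = A$1$1*A$2$2 - A$1$2*A$2$1 + A$1$1*A$3$3 - A$1$3*A$3$1 + A$2$2*A$3$3 - A$2$3*A$3$2"

lemma det_char_poly_3:
  "det (map_matrix complex_of_real A - mat z) =
     - (z^3 - of_real (A$1$1 + A$2$2 + A$3$3) * z^2 + of_real (minors_sum A) * z - of_real (det A))"
  by (simp add: det_3 minors_sum_def map_matrix_def mat_def) algebra

lemma monic_cubic_roots:
  fixes t s d :: complex
  obtains l m n where "t = l + m + n" "s = l*m + l*n + m*n" "d = l*m*n"
proof -
  define f where "f = (\<lambda>k::nat. if k = 0 then -d else if k = 1 then s else if k = 2 then -t else 1)"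
  obtain l where "(\<Sum>k\<le>3. f k * l^k) = 0"
    using alg_closed[of 3 f] by (auto simp: f_def)
  then have l: "l^3 - t*l^2 + s*l - d = 0"
    by (simp add: f_def numeral_3_eq_3 numeral_2_eq_2 algebra_simps)
  \<comment> \<open>Coefficients of the quotient of the cubic by \<open>z - l\<close>. The third
    root is then read off from the sum \<open>t\<close> of the roots.\<close>
  define g where "g = (\<lambda>k::nat. if k = 0 then s - t*l + l^2 else if k = 1 then l - t else 1)"
  obtain m where "(\<Sum>k\<le>2. g k * m^k) = 0"
    using alg_closed[of 2 g] by (auto simp: g_def)
  then have m: "m^2 + (l - t)*m + (s - t*l + l^2) = 0"
    by (simp add: g_def numeral_2_eq_2 algebra_simps)
  show thesis
  proof (rule that[of l m "t - l - m"])
    show "s = l*m + l*(t - l - m) + m*(t - l - m)" "d = l*m*(t - l - m)"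
      using l m by algebra+
  qed simp
qed

text \<open>All complex roots of the characteristic polynomial are eigenvalues, hence real. Only the
  symmetric functions of the roots are kept; positivity is recovered by
  \<open>real_root_eigenvalue_pos\<close> once a triangular form shows the eigenvalues on its
  diagonal.\<close>

lemma positive_real_eigenvalues_3:
  fixes A :: "real^3^3"
  assumes "positive_real_eigenvalues A"
  obtains l m n where "A$1$1 + A$2$2 + A$3$3 = l + m + n" "minors_sum A = l*m + l*n + m*n"
    "det A = l*m*n"
proof -
  obtain l m n where r: "complex_of_real (A$1$1 + A$2$2 + A$3$3) = l + m + n"
      "complex_of_real (minors_sum A) = l*m + l*n + m*n" "complex_of_real (det A) = l*m*n"
    using monic_cubic_roots by metis
  have "z^3 - (l + m + n) * z^2 + (l*m + l*n + m*n) * z - l*m*n = (z - l)*(z - m)*(z - n)" for z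
    by (simp add: power2_eq_square power3_eq_cube algebra_simps)
  then have "complex_eigenvalue A z \<longleftrightarrow> (z - l)*(z - m)*(z - n) = 0" for z
    unfolding complex_eigenvalue_iff_det det_char_poly_3 r by (simp only: neg_equal_0_iff_equal)
  then have "complex_eigenvalue A l" "complex_eigenvalue A m" "complex_eigenvalue A n"
    by simp_all
  then obtain l' m' n' where "l = complex_of_real l'" "m = complex_of_real m'" "n = complex_of_real n'"
    using assms unfolding positive_real_eigenvalues_def by blast
  with r have "complex_of_real (A$1$1 + A$2$2 + A$3$3) = of_real (l' + m' + n')"
      "complex_of_real (minors_sum A) = of_real (l'*m' + l'*n' + m'*n')"
      "complex_of_real (det A) = of_real (l'*m'*n')"
    by simp_all
  then show thesis
    using that unfolding of_real_eq_iff by blast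
qed

lemma real_root_eigenvalue_pos:
  fixes A :: "real^3^3"
  assumes "positive_real_eigenvalues A" "det (A - mat c) = 0"
  shows "c > 0"
proof -
  have "det (map_matrix complex_of_real A - mat (of_real c)) = of_real (det (A - mat c))"
    by (simp add: det_3 map_matrix_def mat_def)
  then have "complex_eigenvalue A (of_real c)"
    using assms(2) by (simp add: complex_eigenvalue_iff_det)
  then show ?thesis
    using assms(1) unfolding positive_real_eigenvalues_def by force
qed

lemma cayley_hamilton_3:
  fixes A :: "real^3^3"
  shows "A *v (A *v (A *v v)) - (A$1$1 + A$2$2 + A$3$3) *\<^sub>R (A *v (A *v v))
    + minors_sum A *\<^sub>R (A *v v) - det A *\<^sub>R v = 0"
  by (simp add: vec_eq_iff forall_3 matrix_vector_mult_def sum_3 minors_sum_def det_3 algebra_simps)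

text \<open>Cayley-Hamilton in factored form. Triangularization uses nothing about the spectrum
  except that some product of real linear factors kills every vector.\<close>

lemma positive_real_eigenvalues_annihilated:
  fixes A :: "real^3^3"
  assumes "positive_real_eigenvalues A"
  shows "\<exists>cs. \<forall>v. foldr (\<lambda>c v. A *v v - c *\<^sub>R v) cs v = 0"
proof -
  obtain l m n where r: "A$1$1 + A$2$2 + A$3$3 = l + m + n" "minors_sum A = l*m + l*n + m*n"
    "det A = l*m*n"
    using positive_real_eigenvalues_3[OF assms] .
  have "foldr (\<lambda>c v. A *v v - c *\<^sub>R v) [l, m, n] v = 0" for v
    using cayley_hamilton_3[of A v] unfolding r
    by (simp add: matrix_vector_mult_diff_distrib matrix_vector_mult_scaleR algebra_simps)
  then show ?thesis
    by blast
qed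

section \<open>Simultaneous triangularization\<close>

text \<open>Applying the factors one after another moves \<open>v\<close> into \<open>W\<close>; the
  last vector still outside \<open>W\<close> is sent into \<open>W\<close> by the next factor, so it
  is an eigenvector modulo \<open>W\<close>.\<close>

lemma foldr_last_outside:
  fixes f :: "'a::real_vector \<Rightarrow> 'a"
  assumes "foldr (\<lambda>c v. f v - c *\<^sub>R v) cs v \<in> W" "v \<notin> W" "v \<in> V"
    and "subspace V" "\<And>x. x \<in> V \<Longrightarrow> f x \<in> V"
  shows "\<exists>u\<in>V - W. \<exists>c. f u - c *\<^sub>R u \<in> W"
  using assms(1)
proof (induction cs)
  case Nil
  then show ?case using assms(2) by simp
next
  case (Cons c cs)
  let ?u = "foldr (\<lambda>c v. f v - c *\<^sub>R v) cs v"
  have "?u \<in> V"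
    using assms by (induction cs) (auto intro: subspace_diff subspace_scale)
  then show ?case
    using Cons by (cases "?u \<in> W") auto
qed

text \<open>On an invariant subspace \<open>V\<close> strictly above \<open>W\<close> of minimal dimension every member of the
  family acts as a scalar modulo \<open>W\<close>, because its eigenspaces modulo \<open>W\<close> are again invariant.\<close>

lemma commuting_family_common_eigenvector_mod:
  fixes F :: "('a::euclidean_space \<Rightarrow> 'a) set" and W :: "'a set"
  assumes lin: "\<And>f. f \<in> F \<Longrightarrow> linear f"
    and comm: "\<And>f g v. f \<in> F \<Longrightarrow> g \<in> F \<Longrightarrow> f (g v) = g (f v)"
    and ann: "\<And>f. f \<in> F \<Longrightarrow> \<exists>cs. \<forall>v. foldr (\<lambda>c v. f v - c *\<^sub>R v) cs v = 0"
    and W: "subspace W" "\<And>f x. f \<in> F \<Longrightarrow> x \<in> W \<Longrightarrow> f x \<in> W" "W \<noteq> UNIV"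
  obtains v where "v \<notin> W" "\<And>f. f \<in> F \<Longrightarrow> \<exists>c. f v - c *\<^sub>R v \<in> W"
proof -
  define Q where "Q V \<longleftrightarrow> subspace V \<and> W \<subset> V \<and> (\<forall>f\<in>F. \<forall>x\<in>V. f x \<in> V)" for V
  have "Q UNIV"
    using W by (auto simp: Q_def)
  then obtain V where V: "Q V" and min: "\<And>U. Q U \<Longrightarrow> dim V \<le> dim U"
    using ex_has_least_nat[of Q UNIV dim] by auto
  \<comment> \<open>The vector is fixed before any \<open>f\<close> is considered; this is what
    makes it common to the whole family.\<close>
  then obtain v where v: "v \<in> V" "v \<notin> W"
    by (auto simp: Q_def)
  have "\<exists>c. f v - c *\<^sub>R v \<in> W" if f: "f \<in> F" for f
  proof -
    obtain cs where "\<And>w. foldr (\<lambda>c v. f v - c *\<^sub>R v) cs w = 0"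
      using ann f by blast
    then have "\<exists>u\<in>V - W. \<exists>c. f u - c *\<^sub>R u \<in> W"
      using V f v subspace_0[OF W(1)]
      by (intro foldr_last_outside[where cs = cs and v = v]) (auto simp: Q_def)
    then obtain u c where u: "u \<in> V" "u \<notin> W" "f u - c *\<^sub>R u \<in> W"
      by blast
    define U where "U = {x\<in>V. f x - c *\<^sub>R x \<in> W}"
    have "Q U"
      unfolding Q_def
    proof (intro conjI ballI)
      show "subspace U"
      proof (rule subspaceI)
        show "0 \<in> U"
          using V W(1) linear_0[OF lin[OF f]] by (auto simp: U_def Q_def subspace_0)
        fix x y assume xy: "x \<in> U" "y \<in> U"
        have "f (x + y) - c *\<^sub>R (x + y) = (f x - c *\<^sub>R x) + (f y - c *\<^sub>R y)"
          by (simp add: linear_add[OF lin[OF f]] algebra_simps)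
        then show "x + y \<in> U"
          using xy V subspace_add[OF W(1)] by (auto simp: U_def Q_def subspace_add)
      next
        fix x and k :: real assume x: "x \<in> U"
        have "f (k *\<^sub>R x) - c *\<^sub>R (k *\<^sub>R x) = k *\<^sub>R (f x - c *\<^sub>R x)"
          by (simp add: linear_scale[OF lin[OF f]] algebra_simps)
        then show "k *\<^sub>R x \<in> U"
          using x V subspace_scale[OF W(1)] by (auto simp: U_def Q_def subspace_scale)
      qed
      have "W \<subseteq> U"
        using V W f by (auto simp: U_def Q_def intro: subspace_diff subspace_scale)
      then show "W \<subset> U"
        using u by (auto simp: U_def)
      fix g x assume g: "g \<in> F" and x: "x \<in> U"
      have "f (g x) - c *\<^sub>R g x = g (f x - c *\<^sub>R x)"
        by (simp add: comm[OF f g] linear_diff[OF lin[OF g]] linear_scale[OF lin[OF g]])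
      then show "g x \<in> U"
        using x g V W(2) by (auto simp: U_def Q_def)
    qed
    then have "U = V"
      using min V by (intro subspace_dim_equal) (auto simp: Q_def U_def)
    then show ?thesis
      using v by (auto simp: U_def)
  qed
  then show thesis
    using that v by blast
qed

text \<open>Taking a common eigenvector modulo the span of the earlier ones, three times, produces
  an invariant flag; the chosen vectors become the columns of \<open>P\<close>.\<close>

lemma simultaneous_triangularization_3:
  fixes \<Gamma> :: "(real^3^3) set"
  assumes comm: "\<And>A B. A \<in> \<Gamma> \<Longrightarrow> B \<in> \<Gamma> \<Longrightarrow> A ** B = B ** A"
    and eig: "\<And>A. A \<in> \<Gamma> \<Longrightarrow> positive_real_eigenvalues A"
  obtains P where "det P \<noteq> 0"
    "\<And>A. A \<in> \<Gamma> \<Longrightarrow> \<exists>p q s x y z. A ** P = P ** mat3 p x y 0 q z 0 0 s"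
proof -
  let ?F = "(\<lambda>A v. A *v v) ` \<Gamma>"
  have step: "\<exists>v. v \<notin> W \<and> (\<forall>A\<in>\<Gamma>. \<exists>c. A *v v - c *\<^sub>R v \<in> W)"
    if W: "subspace W" "\<And>A x. A \<in> \<Gamma> \<Longrightarrow> x \<in> W \<Longrightarrow> A *v x \<in> W" "W \<noteq> UNIV" for W
  proof -
    obtain v where "v \<notin> W" "\<And>f. f \<in> ?F \<Longrightarrow> \<exists>c. f v - c *\<^sub>R v \<in> W"
    proof (rule commuting_family_common_eigenvector_mod[of ?F W])
      show "f (g v) = g (f v)" if "f \<in> ?F" "g \<in> ?F" for f g v
        using that comm by (auto simp: matrix_vector_mul_assoc)
    qed (use W eig positive_real_eigenvalues_annihilated in auto)
    then show ?thesis
      by blast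
  qed
  \<comment> \<open>Every member of the flag must be proper for \<open>step\<close> to apply;
    repeated or zero vectors cover the lower-dimensional members.\<close>
  have dims: "span {u, w} \<noteq> UNIV" for u w :: "real^3"
  proof
    assume "span {u, w} = UNIV"
    then have "dim {u, w} = 3"
      using dim_span[of "{u, w}"] by simp
    moreover have "dim {u, w} \<le> card {u, w}"
      by (rule dim_le_card') simp
    ultimately show False
      using card_insert_le_m1[of 2 "{w}" u] by (simp add: card_insert_if split: if_splits)
  qed
  obtain v1 where v1: "v1 \<notin> {0}" "\<forall>A\<in>\<Gamma>. \<exists>c. A *v v1 - c *\<^sub>R v1 \<in> {0}"
    using step[of "{0}"] dims[of 0 0] by (auto simp: subspace_single_0 UNIV_not_singleton)
  then have e1: "\<exists>p. A *v v1 = p *\<^sub>R v1" if "A \<in> \<Gamma>" for A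
    using that by force
  have inv1: "A *v x \<in> span {v1}" if "A \<in> \<Gamma>" "x \<in> span {v1}" for A x
    using e1[OF that(1)] that(2) 
    by (auto simp: span_singleton matrix_vector_mult_scaleR)
  obtain v2 where v2: "v2 \<notin> span {v1}" "\<forall>A\<in>\<Gamma>. \<exists>c. A *v v2 - c *\<^sub>R v2 \<in> span {v1}"
    using step[of "span {v1}"] inv1 dims[of v1 v1] by auto
  have e2: "\<exists>x q. A *v v2 = x *\<^sub>R v1 + q *\<^sub>R v2" if A: "A \<in> \<Gamma>" for A
  proof -
    obtain c k where "A *v v2 - c *\<^sub>R v2 = k *\<^sub>R v1"
      using v2(2) A by (auto simp: span_singleton)
    then show ?thesis
      by (metis diff_add_cancel)
  qed
  have inv2: "A *v x \<in> span {v1, v2}" if A: "A \<in> \<Gamma>" and x: "x \<in> span {v1, v2}" for A x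
  proof -
    have b: "A *v v1 \<in> span {v1, v2}" "A *v v2 \<in> span {v1, v2}"
      using e1[OF A] e2[OF A] by (metis insertCI span_add span_base span_scale)+
    obtain a c where "x = a *\<^sub>R v1 + c *\<^sub>R v2"
      using x by (auto simp: span_insert algebra_simps)
    then show ?thesis
      using b by (auto simp: matrix_vector_right_distrib matrix_vector_mult_scaleR
          intro: span_add span_scale)
  qed
  obtain v3 where v3: "v3 \<notin> span {v1, v2}" "\<forall>A\<in>\<Gamma>. \<exists>c. A *v v3 - c *\<^sub>R v3 \<in> span {v1, v2}"
    using step[of "span {v1, v2}"] inv2 dims[of v1 v2] by auto
  have e3: "\<exists>y z s. A *v v3 = y *\<^sub>R v1 + z *\<^sub>R v2 + s *\<^sub>R v3" if A: "A \<in> \<Gamma>" for A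
  proof -
    obtain c where "A *v v3 - c *\<^sub>R v3 \<in> span {v1, v2}"
      using v3(2) A by blast
    then obtain a b where "A *v v3 - c *\<^sub>R v3 - a *\<^sub>R v1 = b *\<^sub>R v2"
      by (auto simp: span_insert)
    then have "A *v v3 = a *\<^sub>R v1 + b *\<^sub>R v2 + c *\<^sub>R v3"
      by (simp add: algebra_simps)
    then show ?thesis
      by blast
  qed
  define P :: "real^3^3" where "P = transpose (vector [v1, v2, v3])"
  have mulP: "P *v w = w$1 *\<^sub>R v1 + w$2 *\<^sub>R v2 + w$3 *\<^sub>R v3" for w
    by (simp add: P_def vec_eq_iff matrix_vector_mult_def sum_3 transpose_def algebra_simps)
  \<comment> \<open>Coefficients vanish from the last to the first, since each vector lies outside
    the span of its predecessors.\<close>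
  have "w = 0" if "P *v w = 0" for w
  proof -
    have z: "w$1 *\<^sub>R v1 + w$2 *\<^sub>R v2 + w$3 *\<^sub>R v3 = 0"
      using that mulP by simp
    have "w$3 = 0"
    proof (rule ccontr)
      assume "w$3 \<noteq> 0"
      have "w$3 *\<^sub>R v3 = - (w$1 *\<^sub>R v1 + w$2 *\<^sub>R v2)"
        using z by (metis add.commute eq_neg_iff_add_eq_0)
      moreover have "\<dots> \<in> span {v1, v2}"
        by (intro span_neg span_add span_scale span_base) auto
      ultimately have "w$3 *\<^sub>R v3 \<in> span {v1, v2}"
        by (simp only:)
      then show False
        using v3(1) span_scale[of "w$3 *\<^sub>R v3" _ "inverse (w$3)"] \<open>w$3 \<noteq> 0\<close> by simp
    qed
    moreover have "w$2 = 0"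
    proof (rule ccontr)
      assume "w$2 \<noteq> 0"
      have "w$2 *\<^sub>R v2 = (- w$1) *\<^sub>R v1"
        using z \<open>w$3 = 0\<close> by (simp add: add_eq_0_iff)
      moreover have "\<dots> \<in> span {v1}"
        by (intro span_scale span_base) auto
      ultimately have "w$2 *\<^sub>R v2 \<in> span {v1}"
        by (simp only:)
      then show False
        using v2(1) span_scale[of "w$2 *\<^sub>R v2" _ "inverse (w$2)"] \<open>w$2 \<noteq> 0\<close> by simp
    qed
    ultimately show "w = 0"
      using z v1(1) by (auto simp: vec_eq_iff forall_3)
  qed
  then have "det P \<noteq> 0"
    using matrix_left_invertible_ker invertible_det_nz invertible_left_inverse by metis
  moreover have "\<exists>p q s x y z. A ** P = P ** mat3 p x y 0 q z 0 0 s" if A: "A \<in> \<Gamma>" for A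
  proof -
    obtain p x q y z s where e: "A *v v1 = p *\<^sub>R v1" "A *v v2 = x *\<^sub>R v1 + q *\<^sub>R v2"
      "A *v v3 = y *\<^sub>R v1 + z *\<^sub>R v2 + s *\<^sub>R v3"
      using e1[OF A] e2[OF A] e3[OF A] by blast
    have "A ** P = P ** mat3 p x y 0 q z 0 0 s"
      using e unfolding matrix3_eq_iff vec_eq_iff forall_3
      by (simp add: P_def matrix_matrix_mult_def matrix_vector_mult_def sum_3 transpose_def mult.commute)
    then show ?thesis
      by blast
  qed
  ultimately show thesis
    using that by blast
qed

section \<open>Discrete subgroups of the plane\<close>

text \<open>Signed area of the parallelogram on \<open>u\<close> and \<open>v\<close>; its
  nonvanishing is the form in which linear independence is used throughout.\<close>

definition det2 :: "real \<times> real \<Rightarrow> real \<times> real \<Rightarrow> real" where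
  "det2 u v = fst u * snd v - snd u * fst v"

lemma det2_eq_0_imp_multiple:
  assumes "det2 u v = 0" "u \<noteq> 0"
  shows "\<exists>c. v = c *\<^sub>R u"
proof (cases "fst u = 0")
  case True
  then have "snd u \<noteq> 0" "fst v = 0"
    using assms by (auto simp: det2_def prod_eq_iff)
  with True show ?thesis
    by (intro exI[of _ "snd v / snd u"]) (simp add: prod_eq_iff)
next
  case False
  with assms(1) show ?thesis
    by (intro exI[of _ "fst v / fst u"]) (simp add: prod_eq_iff det2_def field_simps)
qed

text \<open>Cramer's rule.\<close>

lemma det2_basis:
  assumes "det2 u v \<noteq> 0"
  shows "w = (det2 w v / det2 u v) *\<^sub>R u + (det2 u w / det2 u v) *\<^sub>R v"
proof -
  have "det2 u v * fst w = det2 w v * fst u + det2 u w * fst v"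
    "det2 u v * snd w = det2 w v * snd u + det2 u w * snd v"
    by (simp_all add: det2_def algebra_simps)
  with assms show ?thesis
    by (simp add: prod_eq_iff) (simp add: field_simps)
qed

lemma lagrange_identity_plane: "(det2 u v)^2 + (u \<bullet> v)^2 = (norm u)^2 * (norm v)^2"
  unfolding power2_norm_eq_inner by (simp add: det2_def inner_prod_def power2_eq_square algebra_simps)

text \<open>Strict Cauchy-Schwarz: by Lagrange's identity the defect is the square of
  \<open>det2 u v\<close>.\<close>

lemma abs_inner_less_if_det2_nonzero:
  assumes "det2 u v \<noteq> 0"
  shows "\<bar>u \<bullet> v\<bar> < norm u * norm v"
proof -
  have "0 < (det2 u v)^2"
    using assms by simp
  then have "\<bar>u \<bullet> v\<bar>^2 < (norm u * norm v)^2"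
    using lagrange_identity_plane[of u v] unfolding power_mult_distrib power2_abs by linarith
  then show ?thesis
    by (rule power2_less_imp_less) simp
qed

lemma abs_diff_round_le: "\<bar>x - of_int (round x)\<bar> \<le> 1/2" for x :: real
  using of_int_round_abs_le[of x] by (simp add: abs_minus_commute)

text \<open>Take a shortest nonzero \<open>u\<close>, then a shortest \<open>v\<close> off the line
  of \<open>u\<close>. Rounding the coordinates of a member leaves a remainder shorter than
  \<open>v\<close>, which must therefore lie on that line; there, rounding again leaves a remainder
  shorter than \<open>u\<close>, hence zero.\<close>

lemma discrete_plane_subgroup_cases:
  fixes L :: "(real \<times> real) set"
  assumes zero: "0 \<in> L" and diff: "\<And>u v. u \<in> L \<Longrightarrow> v \<in> L \<Longrightarrow> u - v \<in> L"
    and e: "e > 0" "\<And>u. u \<in> L \<Longrightarrow> norm u < e \<Longrightarrow> u = 0"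
  obtains (cyclic) u where "u \<in> L" "\<And>w. w \<in> L \<Longrightarrow> \<exists>m::int. w = of_int m *\<^sub>R u"
  | (rank2) u v where "u \<in> L" "v \<in> L" "det2 u v \<noteq> 0"
      "\<And>w. w \<in> L \<Longrightarrow> \<exists>m n::int. w = of_int m *\<^sub>R u + of_int n *\<^sub>R v"
proof -
  have neg: "- u \<in> L" if "u \<in> L" for u
    using diff[OF zero that] by simp
  have add: "u + v \<in> L" if "u \<in> L" "v \<in> L" for u v
    using diff[OF that(1) neg[OF that(2)]] by simp
  have nat: "of_nat m *\<^sub>R u \<in> L" if "u \<in> L" for m u
    using that by (induction m) (auto simp: zero add scaleR_left_distrib)
  have int: "of_int m *\<^sub>R u \<in> L" if "u \<in> L" for m u
    using nat[OF that] neg by (cases m rule: int_cases2) auto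
  \<comment> \<open>A difference of two members is a member, so the gap \<open>e\<close> around 0
    separates any two points of \<open>L\<close>.\<close>
  have fin: "finite {w\<in>L. norm w \<le> C}" for C
  proof -
    have "uniform_discrete L"
      unfolding uniform_discrete_def
    proof (intro exI conjI ballI impI)
      fix x y assume "x \<in> L" "y \<in> L" "dist x y < e"
      then show "x = y"
        using e(2)[OF diff, of x y] by (simp add: dist_norm)
    qed (rule e)
    then have "uniform_discrete {w\<in>L. norm w \<le> C}"
      by (rule uniform_discrete_subset) auto
    moreover have "bounded {w\<in>L. norm w \<le> C}"
      by (auto simp: bounded_iff)
    ultimately show ?thesis
      using uniform_discrete_finite_iff by blast
  qed
  have shortest: "\<exists>u\<in>M. \<forall>w\<in>M. norm u \<le> norm w" if M: "M \<subseteq> L" "M \<noteq> {}" for M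
  proof -
    obtain v where v: "v \<in> M"
      using M by blast
    have "finite {w\<in>M. norm w \<le> norm v}"
      by (rule finite_subset[OF _ fin[of "norm v"]]) (use M in auto)
    then obtain u where u: "u \<in> M" "norm u \<le> norm v" "\<And>w. w \<in> M \<Longrightarrow> norm w \<le> norm v \<Longrightarrow> norm u \<le> norm w"
      using v by (metis (no_types, lifting) arg_min_if_finite(1) arg_min_least emptyE mem_Collect_eq order_refl)
    then show ?thesis
      by (meson le_cases order_trans)
  qed
  show thesis
  proof (cases "L \<subseteq> {0}")
    case True
    then show ?thesis
      using zero by (intro cyclic[of 0]) auto
  next
    case False
    then obtain u where u: "u \<in> L" "u \<noteq> 0" and u_min: "\<And>w. w \<in> L \<Longrightarrow> w \<noteq> 0 \<Longrightarrow> norm u \<le> norm w"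
      using shortest[of "L - {0}"] by auto
    have line: "\<exists>m::int. w = of_int m *\<^sub>R u" if w: "w \<in> L" "det2 u w = 0" for w
    proof -
      obtain c where c: "w = c *\<^sub>R u"
        using det2_eq_0_imp_multiple w u by blast
      let ?r = "w - of_int (round c) *\<^sub>R u"
      have "?r = (c - of_int (round c)) *\<^sub>R u"
        by (simp add: c algebra_simps)
      then have "norm ?r \<le> 1/2 * norm u"
        using mult_right_mono[OF abs_diff_round_le[of c], of "norm u"] by simp
      then have "norm ?r < norm u"
        using zero_less_norm_iff[of u] u(2) by linarith
      then have "?r = 0"
        using u_min[OF diff[OF w(1) int[OF u(1)]]] by fastforce
      then show ?thesis
        by auto
    qed
    show ?thesis
    proof (cases "\<forall>w\<in>L. det2 u w = 0")
      case True
      then show ?thesis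
        using u line by (intro cyclic[of u]) auto
    next
      case False
      then obtain v where v: "v \<in> L" "det2 u v \<noteq> 0"
        and v_min: "\<And>w. w \<in> L \<Longrightarrow> det2 u w \<noteq> 0 \<Longrightarrow> norm v \<le> norm w"
        using shortest[of "{w\<in>L. det2 u w \<noteq> 0}"] by fastforce
      have "v \<noteq> 0"
        using v(2) by (auto simp: det2_def)
      then have uv: "norm u \<le> norm v" "0 < norm v"
        using u_min v(1) by auto
      show ?thesis
      proof (rule rank2[OF u(1) v])
        fix w assume w: "w \<in> L"
        define a b where "a = det2 w v / det2 u v" and "b = det2 u w / det2 u v"
        define r where "r = w - of_int (round a) *\<^sub>R u - of_int (round b) *\<^sub>R v"
        have r: "r = (a - of_int (round a)) *\<^sub>R u + (b - of_int (round b)) *\<^sub>R v" (is "r = ?a *\<^sub>R u + ?b *\<^sub>R v")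
          unfolding r_def by (subst det2_basis[OF v(2), of w]) (simp add: a_def b_def algebra_simps)
        have "r \<in> L"
          unfolding r_def by (intro diff int w u v)
        have "(norm r)^2 = ?a^2 * (norm u)^2 + ?b^2 * (norm v)^2 + 2 * (?a * ?b * (u \<bullet> v))"
          unfolding r power2_norm_eq_inner by (simp add: inner_add inner_commute power2_eq_square algebra_simps)
        \<comment> \<open>Each square term contributes at most a quarter of the squared norm of
          \<open>v\<close>, the cross term strictly less than a half. Strictness rests on the
          independence of \<open>u\<close> and \<open>v\<close>.\<close>
        also have "\<dots> < (norm v)^2"
        proof -
          have sq: "?a^2 \<le> 1/4" "?b^2 \<le> 1/4"
            using power_mono[OF abs_diff_round_le, where n = 2] by (simp_all add: power_divide)
          have "\<bar>?a * ?b\<bar> \<le> 1/2 * (1/2)"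
            unfolding abs_mult by (intro mult_mono abs_diff_round_le) auto
          then have "\<bar>?a * ?b * (u \<bullet> v)\<bar> \<le> 1/4 * \<bar>u \<bullet> v\<bar>"
            unfolding abs_mult[of "?a * ?b"] by (intro mult_right_mono) auto
          moreover have "\<bar>u \<bullet> v\<bar> < (norm v)^2"
            using abs_inner_less_if_det2_nonzero[OF v(2)] mult_right_mono[OF uv(1), of "norm v"]
            by (simp add: power2_eq_square)
          moreover have "?a^2 * (norm u)^2 \<le> 1/4 * (norm v)^2" "?b^2 * (norm v)^2 \<le> 1/4 * (norm v)^2"
            using mult_mono[OF sq(1) power_mono[OF uv(1)], of 2] mult_right_mono[OF sq(2), of "(norm v)^2"]
            by simp_all
          ultimately show ?thesis
            by linarith
        qed
        finally have "norm r < norm v"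
          by (rule power2_less_imp_less) simp
        then have "det2 u r = 0"
          using v_min \<open>r \<in> L\<close> by fastforce
        then obtain m :: int where "r = of_int m *\<^sub>R u"
          using line \<open>r \<in> L\<close> by blast
        then have "w = of_int (m + round a) *\<^sub>R u + of_int (round b) *\<^sub>R v"
          by (simp add: r_def algebra_simps)
        then show "\<exists>m n::int. w = of_int m *\<^sub>R u + of_int n *\<^sub>R v"
          by blast
      qed
    qed
  qed
qed

section \<open>Two-dimensional model groups\<close>

text \<open>Conjugations are written as \<open>\<phi> u ** Q = Q ** A\<close>, which avoids inverses
  and asks only for nonzero determinant. The disjunction for pairs lets the generators be swapped:
  in the Jordan and regular models the first one must be nondegenerate.\<close>

locale plane_group =
  fixes \<phi> :: "real \<times> real \<Rightarrow> real^3^3"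
  assumes cont: "continuous_on UNIV \<phi>"
    and inj: "inj \<phi>"
    and hom: "\<phi> (u + v) = \<phi> u ** \<phi> v"
    and det_1: "det (\<phi> u) = 1"
    and normal_form: "u \<noteq> 0 \<Longrightarrow> \<exists>A Q. standard_generator A \<and> det Q \<noteq> 0 \<and> \<phi> u ** Q = Q ** A"
    and normal_form_pair: "det2 u v \<noteq> 0 \<Longrightarrow> \<exists>A B Q. standard_generator_pair A B \<and> det Q \<noteq> 0 \<and>
      (\<phi> u ** Q = Q ** A \<and> \<phi> v ** Q = Q ** B \<or> \<phi> v ** Q = Q ** A \<and> \<phi> u ** Q = Q ** B)"

lemma continuous_on_vector_3:
  fixes a b c :: "'a::topological_space \<Rightarrow> 'b::{topological_space, zero}"
  assumes "continuous_on S a" "continuous_on S b" "continuous_on S c"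
  shows "continuous_on S (\<lambda>x. vector [a x, b x, c x] :: 'b^3)"
proof -
  have "(\<lambda>x. vector [a x, b x, c x] :: 'b^3) = (\<lambda>x. \<chi> i. if i = 1 then a x else if i = 2 then b x else c x)"
    by (simp add: fun_eq_iff vec_eq_iff forall_3)
  moreover have "continuous_on S (\<lambda>x. if i = 1 then a x else if i = 2 then b x else c x)" for i :: 3
    using assms by (cases "i = 1"; cases "i = 2") simp_all
  ultimately show ?thesis
    by (simp only: continuous_on_vec_lambda)
qed

lemma normal_form_intro:
  assumes "standard_generator A" "det Q \<noteq> 0" "M ** Q = Q ** A"
  shows "\<exists>A Q. standard_generator A \<and> det Q \<noteq> 0 \<and> M ** Q = Q ** A"
  using assms by blast

lemma normal_form_pair_intro:
  assumes "standard_generator_pair A B" "det Q \<noteq> 0" "M ** Q = Q ** A" "N ** Q = Q ** B"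
  shows "\<exists>A B Q. standard_generator_pair A B \<and> det Q \<noteq> 0 \<and>
    (M ** Q = Q ** A \<and> N ** Q = Q ** B \<or> N ** Q = Q ** A \<and> M ** Q = Q ** B)"
  using assms by blast

section \<open>The five models and their normal forms\<close>

definition diagonal_group :: "real \<times> real \<Rightarrow> real^3^3" where
  "diagonal_group u = mat3 (exp (fst u)) 0 0 0 (exp (snd u)) 0 0 0 (exp (- fst u - snd u))"

text \<open>Exponential of a Jordan block beside a scalar; the factor \<open>exp (fst u)\<close> in
  the off-diagonal entry is what makes the second coordinate additive.\<close>

definition jordan_group :: "real \<times> real \<Rightarrow> real^3^3" where
  "jordan_group u = mat3 (exp (fst u)) (snd u * exp (fst u)) 0 0 (exp (fst u)) 0 0 0 (exp (- 2 * fst u))"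

text \<open>Here every M - 1 has its image in one common line, whereas in
  \<open>column_group\<close> every M - 1 kills one common plane. Transposing and reversing the
  basis exchanges the two, but they are not conjugate: the common fixed vectors form a line here and
  a plane there.\<close>

definition row_group :: "real \<times> real \<Rightarrow> real^3^3" where
  "row_group u = mat3 1 (fst u) (snd u) 0 1 0 0 0 1"

definition column_group :: "real \<times> real \<Rightarrow> real^3^3" where
  "column_group u = mat3 1 0 (fst u) 0 1 (snd u) 0 0 1"

text \<open>The second coordinate is the part of the corner entry not accounted for by the one-parameter
  group through a regular unipotent matrix, which turns addition into matrix multiplication.\<close>

definition regular_group :: "real \<times> real \<Rightarrow> real^3^3" where
  "regular_group u = mat3 1 (fst u) (snd u + fst u * (fst u - 1) / 2) 0 1 (fst u) 0 0 1"

lemma plane_group_diagonal: "plane_group diagonal_group"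
proof
  show "continuous_on UNIV diagonal_group"
    unfolding diagonal_group_def by (intro continuous_on_vector_3 continuous_intros)
  show "inj diagonal_group"
    by (auto simp: inj_def diagonal_group_def mat3_eq_iff)
  fix u v
  show "diagonal_group (u + v) = diagonal_group u ** diagonal_group v"
    by (simp add: diagonal_group_def mat3_mult algebra_simps flip: exp_add)
  show "det (diagonal_group u) = 1"
    by (simp add: diagonal_group_def det_mat3 flip: exp_add)
  show "\<exists>A Q. standard_generator A \<and> det Q \<noteq> 0 \<and> diagonal_group u ** Q = Q ** A" if "u \<noteq> 0"
    using that standard_generator.type3[of "fst u" "snd u" "- fst u - snd u"]
    by (intro normal_form_intro[of "diagonal_group u"
        "mat 1"]) (auto simp: diagonal_group_def prod_eq_iff)
  show "\<exists>A B Q. standard_generator_pair A B \<and> det Q \<noteq> 0 \<and>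
      (diagonal_group u ** Q = Q ** A \<and> diagonal_group v ** Q = Q ** B \<or>
       diagonal_group v ** Q = Q ** A \<and> diagonal_group u ** Q = Q ** B)"
    using standard_generator_pair.type3[of "fst u" "snd u" "- fst u - snd u" "fst v" "snd v" "- fst v - snd v"]
    by (intro normal_form_pair_intro[of "diagonal_group u"
        "diagonal_group v"
        "mat 1"])
      (auto simp: diagonal_group_def)
qed

lemma plane_group_jordan: "plane_group jordan_group"
proof
  show "continuous_on UNIV jordan_group"
    unfolding jordan_group_def by (intro continuous_on_vector_3 continuous_intros)
  show "inj jordan_group"
    by (auto simp: inj_def jordan_group_def mat3_eq_iff)
  show "jordan_group (u + v) = jordan_group u ** jordan_group v" for u v
    by (simp add: jordan_group_def mat3_mult algebra_simps flip: exp_add)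
  show "det (jordan_group u) = 1" for u
    by (simp add: jordan_group_def det_mat3 flip: exp_add)
  show "\<exists>A Q. standard_generator A \<and> det Q \<noteq> 0 \<and> jordan_group u ** Q = Q ** A" if "u \<noteq> 0" for u
  proof (cases "snd u = 0")
    case True
    then show ?thesis
      using that standard_generator.type3[of "fst u" "fst u" "- 2 * fst u"]
      by (intro normal_form_intro[of "jordan_group u"
        "mat 1"]) (auto simp: jordan_group_def prod_eq_iff)
  next
    case False
    \<comment> \<open>For \<open>fst u = 0\<close> the type (4) shape degenerates to type
      (1).\<close>
    have "standard_generator (mat3 (exp (fst u)) 1 0 0 (exp (fst u)) 0 0 0 (exp (- 2 * fst u)))"
      using standard_generator.type1 standard_generator.type4[of "fst u"] by (cases "fst u = 0") auto
    with False show ?thesis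
      by (intro normal_form_intro[of "mat3 (exp (fst u)) 1 0 0 (exp (fst u)) 0 0 0 (exp (- 2 * fst u))"
        "mat3 (snd u * exp (fst u)) 0 0 0 1 0 0 0 1"])
        (simp_all add: jordan_group_def mat3_mult det_mat3 mat3_eq_iff)
  qed
  have pair: "\<exists>A B Q. standard_generator_pair A B \<and> det Q \<noteq> 0 \<and>
      (jordan_group u ** Q = Q ** A \<and> jordan_group v ** Q = Q ** B \<or>
       jordan_group v ** Q = Q ** A \<and> jordan_group u ** Q = Q ** B)"
    if "det2 u v \<noteq> 0" "snd u \<noteq> 0" for u v
  proof -
    \<comment> \<open>\<open>Q\<close> rescales the first basis vector so that the off-diagonal
      entry for \<open>u\<close> becomes 1; the one for \<open>v\<close> becomes the quotient of the
      two.\<close>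
    let ?a = "snd v * exp (fst v) / (snd u * exp (fst u))"
    have "(fst v, fst u) \<noteq> (0, 0)"
      using that(1) by (auto simp: det2_def)
    from standard_generator_pair.type4[OF this, of ?a] that(2) show ?thesis
      by (intro normal_form_pair_intro[of "mat3 (exp (fst u)) 1 0 0 (exp (fst u)) 0 0 0 (exp (- 2 * fst u))"
        "mat3 (exp (fst v)) ?a 0 0 (exp (fst v)) 0 0 0 (exp (- 2 * fst v))"
        "mat3 (snd u * exp (fst u)) 0 0 0 1 0 0 0 1"])
        (simp_all add: jordan_group_def mat3_mult det_mat3 mat3_eq_iff)
  qed
  show "\<exists>A B Q. standard_generator_pair A B \<and> det Q \<noteq> 0 \<and>
      (jordan_group u ** Q = Q ** A \<and> jordan_group v ** Q = Q ** B \<or>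
       jordan_group v ** Q = Q ** A \<and> jordan_group u ** Q = Q ** B)" if "det2 u v \<noteq> 0" for u v
  proof (cases "snd u = 0")
    case True
    then have "det2 v u \<noteq> 0" "snd v \<noteq> 0"
      using that by (auto simp: det2_def)
    from pair[OF this] show ?thesis by blast
  next
    case False
    from pair[OF that this] show ?thesis by blast
  qed
qed

lemma plane_group_row: "plane_group row_group"
proof
  show "continuous_on UNIV row_group"
    unfolding row_group_def by (intro continuous_on_vector_3 continuous_intros)
  show "inj row_group"
    by (auto simp: inj_def row_group_def mat3_eq_iff prod_eq_iff)
  fix u v
  show "row_group (u + v) = row_group u ** row_group v"
    by (simp add: row_group_def mat3_mult algebra_simps)
  show "det (row_group u) = 1"
    by (simp add: row_group_def det_mat3)
  show "\<exists>A Q. standard_generator A \<and> det Q \<noteq> 0 \<and> row_group u ** Q = Q ** A" if "u \<noteq> 0"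
  proof -
    \<comment> \<open>With M = \<open>row_group u\<close>, M - 1 sends the second column of
      \<open>Q\<close>, built from \<open>u\<close> itself, to the first column, and kills the
      third, which is orthogonal to \<open>u\<close>.\<close>
    let ?S = "fst u * fst u + snd u * snd u"
    have "?S \<noteq> 0"
      using that by (simp add: sum_squares_eq_zero_iff prod_eq_iff)
    moreover have "det (mat3 ?S 0 0 0 (fst u) (- snd u) 0 (snd u) (fst u)) = ?S * ?S"
      by (simp add: det_mat3 algebra_simps)
    ultimately show ?thesis
      using standard_generator.type1
      by (intro normal_form_intro[of "mat3 1 1 0 0 1 0 0 0 1"
          "mat3 ?S 0 0 0 (fst u) (- snd u) 0 (snd u) (fst u)"])
        (simp_all add: row_group_def mat3_mult mat3_eq_iff)
  qed
  show "\<exists>A B Q. standard_generator_pair A B \<and> det Q \<noteq> 0 \<and>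
      (row_group u ** Q = Q ** A \<and> row_group v ** Q = Q ** B \<or>
       row_group v ** Q = Q ** A \<and> row_group u ** Q = Q ** B)" if "det2 u v \<noteq> 0"
  proof -
    \<comment> \<open>The lower block is the adjugate of the matrix with rows \<open>u\<close> and
      \<open>v\<close>: up to the factor \<open>det2 u v\<close>, its columns are the dual
      basis.\<close>
    let ?Q = "mat3 (det2 u v) 0 0 0 (snd v) (- snd u) 0 (- fst v) (fst u)"
    have "det ?Q = det2 u v * det2 u v"
      by (simp add: det_mat3 det2_def algebra_simps)
    with that show ?thesis
      using standard_generator_pair.type1
      by (intro normal_form_pair_intro[of "mat3 1 1 0 0 1 0 0 0 1" "mat3 1 0 1 0 1 0 0 0 1" ?Q])
        (simp_all add: row_group_def mat3_mult mat3_eq_iff det2_def)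
  qed
qed

lemma plane_group_column: "plane_group column_group"
proof
  show "continuous_on UNIV column_group"
    unfolding column_group_def by (intro continuous_on_vector_3 continuous_intros)
  show "inj column_group"
    by (auto simp: inj_def column_group_def mat3_eq_iff prod_eq_iff)
  fix u v
  show "column_group (u + v) = column_group u ** column_group v"
    by (simp add: column_group_def mat3_mult algebra_simps)
  show "det (column_group u) = 1"
    by (simp add: column_group_def det_mat3)
  show "\<exists>A Q. standard_generator A \<and> det Q \<noteq> 0 \<and> column_group u ** Q = Q ** A" if "u \<noteq> 0"
  proof -
    have "fst u * fst u + snd u * snd u \<noteq> 0"
      using that by (simp add: sum_squares_eq_zero_iff prod_eq_iff)
    \<comment> \<open>Columns of \<open>Q\<close>: the image of the third basis vector under M - 1,
      that basis vector itself, and a fixed vector orthogonal to \<open>u\<close>.\<close>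
    then show ?thesis
      using standard_generator.type1
      by (intro normal_form_intro[of "mat3 1 1 0 0 1 0 0 0 1"
          "mat3 (fst u) 0 (- snd u) (snd u) 0 (fst u) 0 1 0"])
        (simp_all add: column_group_def mat3_mult det_mat3 mat3_eq_iff add_eq_0_iff)
  qed
  show "\<exists>A B Q. standard_generator_pair A B \<and> det Q \<noteq> 0 \<and>
      (column_group u ** Q = Q ** A \<and> column_group v ** Q = Q ** B \<or>
       column_group v ** Q = Q ** A \<and> column_group u ** Q = Q ** B)" if "det2 u v \<noteq> 0"
    using that standard_generator_pair.type1'
    \<comment> \<open>The nilpotent parts send the third basis vector to \<open>v\<close> and
      \<open>u\<close>, which together with it form the new basis.\<close>
    by (intro normal_form_pair_intro[of "mat3 1 0 0 0 1 1 0 0 1"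
        "mat3 1 0 1 0 1 0 0 0 1"
        "mat3 (fst v) (fst u) 0 (snd v) (snd u) 0 0 0 1"])
      (auto simp: column_group_def mat3_mult det_mat3 mat3_eq_iff det2_def algebra_simps)
qed

lemma plane_group_regular: "plane_group regular_group"
proof
  show "continuous_on UNIV regular_group"
    unfolding regular_group_def by (intro continuous_on_vector_3 continuous_intros) auto
  show "inj regular_group"
    by (auto simp: inj_def regular_group_def mat3_eq_iff prod_eq_iff)
  show "regular_group (u + v) = regular_group u ** regular_group v" for u v
    by (simp add: regular_group_def mat3_mult mat3_eq_iff field_simps)
  show "det (regular_group u) = 1" for u
    by (simp add: regular_group_def det_mat3)
  show "\<exists>A Q. standard_generator A \<and> det Q \<noteq> 0 \<and> regular_group u ** Q = Q ** A" if "u \<noteq> 0" for u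
  proof (cases "fst u = 0")
    case True
    \<comment> \<open>Only the corner entry is left; exchanging the last two basis vectors moves it
      next to the diagonal.\<close>
    then show ?thesis
      using that standard_generator.type1
      by (intro normal_form_intro[of "mat3 1 1 0 0 1 0 0 0 1"
        "mat3 (snd u) 0 0 0 0 1 0 1 0"])
        (auto simp: regular_group_def mat3_mult det_mat3 mat3_eq_iff prod_eq_iff)
  next
    case False
    \<comment> \<open>The columns of \<open>Q\<close> are the Jordan chain N^2 e, N e, e, with N = M
      - 1 and e the last basis vector.\<close>
    then show ?thesis
      using standard_generator.type2
      by (intro normal_form_intro[of "mat3 1 1 0 0 1 1 0 0 1"
        "mat3 ((fst u)^2) (snd u + fst u * (fst u - 1) / 2) 0 0 (fst u) 0 0 0 1"])
        (auto simp: regular_group_def mat3_mult det_mat3 mat3_eq_iff power2_eq_square)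
  qed
  have pair: "\<exists>A B Q. standard_generator_pair A B \<and> det Q \<noteq> 0 \<and>
      (regular_group u ** Q = Q ** A \<and> regular_group v ** Q = Q ** B \<or>
       regular_group v ** Q = Q ** A \<and> regular_group u ** Q = Q ** B)"
    if uv: "det2 u v \<noteq> 0" "fst u \<noteq> 0" for u v
  proof -
    define b where "b = snd u + fst u * (fst u - 1) / 2"
    define b' where "b' = snd v + fst v * (fst v - 1) / 2"
    \<comment> \<open>In the Jordan chain of \<open>u\<close>, with N the nilpotent part for
      \<open>u\<close>, the nilpotent part for \<open>v\<close> is \<alpha> N + \<beta> N^2.\<close>
    define \<alpha> where "\<alpha> = fst v / fst u"
    define \<beta> where "\<beta> = (b' - \<alpha> * b) / (fst u)^2"
    have v: "fst v = \<alpha> * fst u" "b' = \<alpha> * b + \<beta> * (fst u)^2"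
      using uv(2) by (simp_all add: \<alpha>_def \<beta>_def)
    \<comment> \<open>The excluded value \<alpha> (\<alpha> - 1) / 2 is the binomial coefficient of
      N^2 in the real power (1 + N)^\<alpha>: attaining it would put \<open>v\<close> on the line of
      \<open>u\<close>.\<close>
    have "2 * (\<beta> - \<alpha> * (\<alpha> - 1) / 2) * (fst u)^3 = 2 * det2 u v"
    proof -
      have "\<beta> * (fst u)^2 = snd v + fst v * (fst v - 1) / 2 - \<alpha> * b"
        using v(2) by (simp add: b'_def)
      then have "2 * \<beta> * (fst u)^3 = 2 * snd v * fst u + fst v * (fst v - 1) * fst u - 2 * \<alpha> * b * fst u"
        by (simp add: power3_eq_cube power2_eq_square field_simps) algebra
      then show ?thesis
        unfolding det2_def v(1) b_def by (simp add: power3_eq_cube field_simps)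
    qed
    then have "\<beta> \<noteq> \<alpha> * (\<alpha> - 1) / 2"
      using uv by force
    have "regular_group u = mat3 1 (fst u) b 0 1 (fst u) 0 0 1"
      by (simp add: regular_group_def b_def)
    moreover have "regular_group v = mat3 1 (\<alpha> * fst u) (\<alpha> * b + \<beta> * (fst u)^2) 0 1 (\<alpha> * fst u) 0 0 1"
      unfolding v(1)[symmetric] v(2)[symmetric] by (simp add: regular_group_def b'_def)
    ultimately show ?thesis
      using uv(2) standard_generator_pair.type2[OF \<open>\<beta> \<noteq> \<alpha> * (\<alpha> - 1) / 2\<close>]
      by (intro normal_form_pair_intro[of "mat3 1 1 0 0 1 1 0 0 1" "mat3 1 \<alpha> \<beta> 0 1 \<alpha> 0 0 1"
          "mat3 ((fst u)^2) b 0 0 (fst u) 0 0 0 1"])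
        (simp_all add: mat3_mult det_mat3 mat3_eq_iff power2_eq_square)
  qed
  show "\<exists>A B Q. standard_generator_pair A B \<and> det Q \<noteq> 0 \<and>
      (regular_group u ** Q = Q ** A \<and> regular_group v ** Q = Q ** B \<or>
       regular_group v ** Q = Q ** A \<and> regular_group u ** Q = Q ** B)" if "det2 u v \<noteq> 0" for u v
  proof (cases "fst u = 0")
    case True
    then have "det2 v u \<noteq> 0" "fst v \<noteq> 0"
      using that by (auto simp: det2_def)
    from pair[OF this] show ?thesis by blast
  next
    case False
    from pair[OF that this] show ?thesis by blast
  qed
qed

section \<open>Commuting upper triangular matrices\<close>

lemma diagonal_in_group:
  assumes "p > 0" "q > 0" "s > 0" "p * q * s = 1"
  shows "\<exists>w. mat3 p 0 0 0 q 0 0 0 s = diagonal_group w"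
proof -
  have "s = exp (- ln p - ln q)"
    using assms by (simp add: exp_diff exp_minus field_simps)
  then show ?thesis
    using assms by (intro exI[of _ "(ln p, ln q)"]) (simp add: diagonal_group_def)
qed

lemma jordan_in_group:
  assumes "q > 0" "p > 0" "q * q * p = 1"
  shows "\<exists>w. mat3 q c 0 0 q 0 0 0 p = jordan_group w"
proof -
  have "exp (- 2 * ln q) * exp (ln q) * exp (ln q) = 1"
    by (simp flip: exp_add)
  then have "exp (- 2 * ln q) * q * q = 1"
    using assms by simp
  then have "p = exp (- 2 * ln q)"
    using assms(3) by algebra
  then show ?thesis
    using assms by (intro exI[of _ "(ln q, c / q)"]) (simp add: jordan_group_def)
qed

text \<open>The (1,2), (2,3) and (1,3) entries of the relation, arranged to pair off-diagonal
  entries with differences of diagonal ones.\<close>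

lemma mat3_upper_commute:
  fixes p q s x y z :: "'a::comm_ring_1"
  assumes "mat3 p x y 0 q z 0 0 s ** mat3 p' x' y' 0 q' z' 0 0 s' =
    mat3 p' x' y' 0 q' z' 0 0 s' ** mat3 p x y 0 q z 0 0 s"
  shows "x * (q' - p') = x' * (q - p)" "z * (s' - q') = z' * (s - q)"
    "y * (s' - p') + x * z' = y' * (s - p) + x' * z"
  using assms by (simp_all add: mat3_mult mat3_eq_iff algebra_simps)

text \<open>Entries are functions of the matrix, so that a proportionality between two entries can
  be asserted over all of \<open>S\<close> with one constant.\<close>

locale commuting_triangular =
  fixes S :: "(real^3^3) set"
    and p q s x y z :: "real^3^3 \<Rightarrow> real"
  assumes form: "A \<in> S \<Longrightarrow> A = mat3 (p A) (x A) (y A) 0 (q A) (z A) 0 0 (s A)"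
    and pos: "A \<in> S \<Longrightarrow> p A > 0" "A \<in> S \<Longrightarrow> q A > 0" "A \<in> S \<Longrightarrow> s A > 0"
    and det: "A \<in> S \<Longrightarrow> p A * q A * s A = 1"
    and comm: "A \<in> S \<Longrightarrow> B \<in> S \<Longrightarrow> A ** B = B ** A"
begin

lemma entries_commute:
  assumes "A \<in> S" "B \<in> S"
  shows "x A * (q B - p B) = x B * (q A - p A)" "z A * (s B - q B) = z B * (s A - q A)"
    "y A * (s B - p B) + x A * z B = y B * (s A - p A) + x B * z A"
proof -
  have "mat3 (p A) (x A) (y A) 0 (q A) (z A) 0 0 (s A) ** mat3 (p B) (x B) (y B) 0 (q B) (z B) 0 0 (s B) =
      mat3 (p B) (x B) (y B) 0 (q B) (z B) 0 0 (s B) ** mat3 (p A) (x A) (y A) 0 (q A) (z A) 0 0 (s A)"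
    using comm[OF assms] form[OF assms(1)] form[OF assms(2)] by metis
  note mat3_upper_commute[OF this]
  then show "x A * (q B - p B) = x B * (q A - p A)" "z A * (s B - q B) = z B * (s A - q A)"
    "y A * (s B - p B) + x A * z B = y B * (s A - p A) + x B * z A"
    by auto
qed

lemma model_groupI:
  assumes "plane_group \<phi>" "det P \<noteq> 0"
    and "\<And>A. A \<in> S \<Longrightarrow> \<exists>w. mat3 (p A) (x A) (y A) 0 (q A) (z A) 0 0 (s A) ** P = P ** \<phi> w"
  shows "\<exists>\<phi> P. plane_group \<phi> \<and> det P \<noteq> 0 \<and> (\<forall>A\<in>S. \<exists>w. A ** P = P ** \<phi> w)"
  using assms form by metis

lemma proportional:
  fixes f g :: "real^3^3 \<Rightarrow> real"
  assumes "B \<in> S" "g B \<noteq> 0" "\<And>A. A \<in> S \<Longrightarrow> f A * g B = f B * g A"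
  obtains k where "\<And>A. A \<in> S \<Longrightarrow> f A = k * g A"
proof (rule that[of "f B / g B"])
  show "f A = f B / g B * g A" if "A \<in> S" for A
    using assms(2) assms(3)[OF that] by (simp add: field_simps)
qed

text \<open>The columns of each \<open>P\<close> are common eigenvectors or generalized eigenvectors; that one choice of
  the constants \<open>k\<close>, \<open>m\<close>, \<open>j\<close> serves all of \<open>S\<close> is what commutativity of the entries gives.\<close>

lemma model_group:
  "\<exists>\<phi> P. plane_group \<phi> \<and> det P \<noteq> 0 \<and> (\<forall>A\<in>S. \<exists>w. A ** P = P ** \<phi> w)"
proof (cases "\<forall>A\<in>S. p A = q A")
  case pq: False
  then obtain B where "B \<in> S" "q B - p B \<noteq> 0"
    by auto
  then obtain k where k: "\<And>A. A \<in> S \<Longrightarrow> x A = k * (q A - p A)"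
    using proportional[of B "\<lambda>A. q A - p A" x] entries_commute(1) by metis
  show ?thesis
  proof (cases "\<forall>A\<in>S. q A = s A")
    case True
    have "y A * (q B - p B) + x A * z B = y B * (q A - p A) + x B * z A" if "A \<in> S" for A
      using entries_commute(3)[OF that \<open>B \<in> S\<close>] that True \<open>B \<in> S\<close> by simp
    then have "(y A - k * z A) * (q B - p B) = (y B - k * z B) * (q A - p A)" if "A \<in> S" for A
      using that k \<open>B \<in> S\<close> by (fastforce simp: algebra_simps)
    then obtain j where j: "\<And>A. A \<in> S \<Longrightarrow> y A - k * z A = j * (q A - p A)"
      using proportional[of B "\<lambda>A. q A - p A" "\<lambda>A. y A - k * z A"] \<open>B \<in> S\<close> \<open>q B - p B \<noteq> 0\<close> by metis
    \<comment> \<open>Columns of \<open>P\<close>: an eigenvector for q, a generalized one above it,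
      and the eigenvector for p, placed last to match \<open>jordan_group\<close>.\<close>
    show ?thesis
    proof (rule model_groupI[OF plane_group_jordan, where P = "mat3 k j 1 1 0 0 0 1 0"])
      fix A assume A: "A \<in> S"
      have "q A * q A * p A = 1"
        using det[OF A] True A by (simp add: mult_ac)
      then obtain w where "mat3 (q A) (z A) 0 0 (q A) 0 0 0 (p A) = jordan_group w"
        using jordan_in_group pos[OF A] by blast
      moreover have "y A = k * z A + j * (q A - p A)"
        using j[OF A] by simp
      ultimately show "\<exists>w. mat3 (p A) (x A) (y A) 0 (q A) (z A) 0 0 (s A) ** mat3 k j 1 1 0 0 0 1 0
          = mat3 k j 1 1 0 0 0 1 0 ** jordan_group w"
        using k[OF A] True A
        by (intro exI[of _ w]) (simp add: mat3_mult mat3_eq_iff algebra_simps flip: \<open>_ = jordan_group w\<close>)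
    qed (simp add: det_mat3)
  next
    case False
    then obtain C where "C \<in> S" "s C - q C \<noteq> 0"
      by auto
    then obtain m where m: "\<And>A. A \<in> S \<Longrightarrow> z A = m * (s A - q A)"
      using proportional[of C "\<lambda>A. s A - q A" z] entries_commute(2) by metis
    \<comment> \<open>\<open>y A + x A * m\<close> is the first coordinate of \<open>A\<close>
      applied to (0, m, 1), a vector whose other coordinates are merely scaled by
      \<open>s A\<close>.\<close>
    have rel: "(y A + x A * m) * (s D - p D) = (y D + x D * m) * (s A - p A)"
      if "A \<in> S" "D \<in> S" for A D
    proof -
      have "y A * (s D - p D) + k * (q A - p A) * (m * (s D - q D)) =
          y D * (s A - p A) + k * (q D - p D) * (m * (s A - q A))"
        using entries_commute(3)[OF that] that by (simp add: k m)
      then show ?thesis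
        unfolding k[OF that(1)] k[OF that(2)] by algebra
    qed
    show ?thesis
    proof (cases "\<forall>A\<in>S. p A = s A")
      case True
      show ?thesis
      proof (rule model_groupI[OF plane_group_jordan, where P = "mat3 1 0 k 0 m 1 0 1 0"])
        fix A assume A: "A \<in> S"
        have "p A = s A"
          using True A by blast
        then have "p A * p A * q A = 1"
          using det[OF A] by (simp add: mult_ac)
        then obtain w where "mat3 (p A) (y A + x A * m) 0 0 (p A) 0 0 0 (q A) = jordan_group w"
          using jordan_in_group pos[OF A] by blast
        then show "\<exists>w. mat3 (p A) (x A) (y A) 0 (q A) (z A) 0 0 (s A) ** mat3 1 0 k 0 m 1 0 1 0
            = mat3 1 0 k 0 m 1 0 1 0 ** jordan_group w"
          using k[OF A] m[OF A] True A
          by (intro exI[of _ w]) (simp add: mat3_mult mat3_eq_iff algebra_simps flip: \<open>_ = jordan_group w\<close>)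
      qed (simp add: det_mat3)
    next
      case False
      \<comment> \<open>\<open>B\<close>, \<open>C\<close> and \<open>D\<close> may differ: no
        single member has to have three distinct eigenvalues.\<close>
      then obtain D where "D \<in> S" "s D - p D \<noteq> 0"
        by auto
      then obtain j where j: "\<And>A. A \<in> S \<Longrightarrow> y A + x A * m = j * (s A - p A)"
        using proportional[of D "\<lambda>A. s A - p A" "\<lambda>A. y A + x A * m"] rel by metis
      show ?thesis
      proof (rule model_groupI[OF plane_group_diagonal, where P = "mat3 1 k j 0 1 m 0 0 1"])
        fix A assume A: "A \<in> S"
        obtain w where "mat3 (p A) 0 0 0 (q A) 0 0 0 (s A) = diagonal_group w"
          using diagonal_in_group pos[OF A] det[OF A] by blast
        then show "\<exists>w. mat3 (p A) (x A) (y A) 0 (q A) (z A) 0 0 (s A) ** mat3 1 k j 0 1 m 0 0 1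
            = mat3 1 k j 0 1 m 0 0 1 ** diagonal_group w"
          using k[OF A] m[OF A] j[OF A]
          by (intro exI[of _ w]) (simp add: mat3_mult mat3_eq_iff algebra_simps flip: \<open>_ = diagonal_group w\<close>)
      qed (simp add: det_mat3)
    qed
  qed
next
  case pq: True
  show ?thesis
  proof (cases "\<forall>A\<in>S. q A = s A")
    case False
    then obtain B where "B \<in> S" "s B - q B \<noteq> 0"
      by auto
    then obtain m where m: "\<And>A. A \<in> S \<Longrightarrow> z A = m * (s A - q A)"
      using proportional[of B "\<lambda>A. s A - q A" z] entries_commute(2) by metis
    have "(y A + x A * m) * (s B - q B) = (y B + x B * m) * (s A - q A)" if "A \<in> S" for A
      using entries_commute(3)[OF that \<open>B \<in> S\<close>] m pq that \<open>B \<in> S\<close> by (simp add: algebra_simps)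
    then obtain j where j: "\<And>A. A \<in> S \<Longrightarrow> y A + x A * m = j * (s A - q A)"
      using proportional[of B "\<lambda>A. s A - q A" "\<lambda>A. y A + x A * m"] \<open>B \<in> S\<close> \<open>s B - q B \<noteq> 0\<close> by metis
    show ?thesis
    proof (rule model_groupI[OF plane_group_jordan, where P = "mat3 1 0 j 0 1 m 0 0 1"])
      fix A assume A: "A \<in> S"
      have "q A * q A * s A = 1"
        using det[OF A] pq A by simp
      then obtain w where "mat3 (q A) (x A) 0 0 (q A) 0 0 0 (s A) = jordan_group w"
        using jordan_in_group pos[OF A] by blast
      then show "\<exists>w. mat3 (p A) (x A) (y A) 0 (q A) (z A) 0 0 (s A) ** mat3 1 0 j 0 1 m 0 0 1
          = mat3 1 0 j 0 1 m 0 0 1 ** jordan_group w"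
        using m[OF A] j[OF A] pq A
        by (intro exI[of _ w]) (simp add: mat3_mult mat3_eq_iff algebra_simps flip: \<open>_ = jordan_group w\<close>)
    qed (simp add: det_mat3)
  next
    case qs: True
    have unipotent: "p A = 1" "q A = 1" "s A = 1" if A: "A \<in> S" for A
    proof -
      have "p A ^ 3 = 1"
        using det[OF A] pq qs A by (simp add: power3_eq_cube)
      then show "p A = 1"
        using pos(1)[OF A] power_inject_base[of "p A" 2 1] by simp
      then show "q A = 1" "s A = 1"
        using pq qs A by auto
    qed
    have xz: "x A * z B = x B * z A" if "A \<in> S" "B \<in> S" for A B
      using entries_commute(3)[OF that] that by (simp add: unipotent)
    show ?thesis
    proof (cases "\<exists>B\<in>S. x B * z B \<noteq> 0")
      case True
      then obtain B where B: "B \<in> S" "x B \<noteq> 0" "z B \<noteq> 0"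
        by auto
      \<comment> \<open>Diagonal scaling that turns both superdiagonal entries of \<open>B\<close>
        into 1.\<close>
      let ?P = "mat3 (x B * z B) 0 0 0 (z B) 0 0 0 1"
      show ?thesis
      proof (rule model_groupI[OF plane_group_regular, where P = ?P])
        fix A assume A: "A \<in> S"
        define a b where "a = x A / x B" and "b = y A / (x B * z B)"
        have "mat3 1 a b 0 1 a 0 0 1 = regular_group (a, b - a * (a - 1) / 2)"
          by (simp add: regular_group_def)
        moreover have "x A = a * x B" "z A = a * z B" "y A = b * (x B * z B)"
          using B xz[OF A B(1)] by (simp_all add: a_def b_def field_simps)
        ultimately show "\<exists>w. mat3 (p A) (x A) (y A) 0 (q A) (z A) 0 0 (s A) ** ?P = ?P ** regular_group w"
          using unipotent[OF A]
          by (intro exI[of _ "(a, b - a * (a - 1) / 2)"]) (simp add: mat3_mult mat3_eq_iff flip: \<open>_ = regular_group _\<close>)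
      qed (use B in \<open>simp add: det_mat3\<close>)
    next
      case rank1: False
      show ?thesis
      proof (cases "\<forall>A\<in>S. z A = 0")
        case True
        show ?thesis
        proof (rule model_groupI[OF plane_group_row, where P = "mat 1"])
          show "\<exists>w. mat3 (p A) (x A) (y A) 0 (q A) (z A) 0 0 (s A) ** mat 1 = mat 1 ** row_group w"
            if "A \<in> S" for A
            using True that unipotent by (intro exI[of _ "(x A, y A)"]) (simp add: row_group_def)
        qed simp
      next
        case False
        then obtain B where B: "B \<in> S" "z B \<noteq> 0"
          by blast
        \<comment> \<open>\<open>rank1\<close> gives \<open>x B = 0\<close>, and parallelism with
          \<open>B\<close> spreads this to all of \<open>S\<close>.\<close>
        then have "x A = 0" if "A \<in> S" for A
          using rank1 xz[OF that B(1)] by auto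
        then show ?thesis
          using unipotent
          by (intro model_groupI[OF plane_group_column, where P = "mat 1"] exI[of _ "(y _, z _)"])
            (simp_all add: column_group_def)
      qed
    qed
  qed
qed

end

section \<open>Conjugation into a model group\<close>

lemma continuous_on_matrix_mult:
  fixes f :: "'a::topological_space \<Rightarrow> real^'n^'m" and g :: "'a \<Rightarrow> real^'p^'n"
  assumes "continuous_on S f" "continuous_on S g"
  shows "continuous_on S (\<lambda>x. f x ** g x)"
  unfolding matrix_matrix_mult_def using assms
  by (intro continuous_on_vec_lambda continuous_intros) auto

text \<open>Allows \<Gamma> itself, rather than a conjugate of it, to lie in the range of a model;
  the normalizing matrix \<open>Q\<close> becomes \<open>P ** Q\<close>.\<close>

lemma plane_group_conjugate:
  assumes "plane_group \<phi>" "P ** R = mat 1"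
  shows "plane_group (\<lambda>w. P ** \<phi> w ** R)"
proof -
  interpret plane_group \<phi> by fact
  have RP: "R ** P = mat 1"
    using assms(2) by (simp add: matrix_left_right_inverse)
  have cancel: "X ** R ** P = X" "X ** P ** R = X" for X :: "real^3^3"
    by (simp_all add: assms(2) RP flip: matrix_mul_assoc)
  have det: "det P * det R = 1"
    using assms(2) by (metis det_I det_mul)
  show ?thesis
  proof
    show "continuous_on UNIV (\<lambda>w. P ** \<phi> w ** R)"
      by (intro continuous_on_matrix_mult cont continuous_on_const)
    show "inj (\<lambda>w. P ** \<phi> w ** R)"
    proof (rule injI)
      fix u v assume "P ** \<phi> u ** R = P ** \<phi> v ** R"
      then have "R ** (P ** \<phi> u ** R ** P) = R ** (P ** \<phi> v ** R ** P)"
        by simp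
      then have "\<phi> u = \<phi> v"
        by (simp add: cancel matrix_mul_assoc RP)
      then show "u = v"
        using inj by (simp add: inj_eq)
    qed
    fix u v
    show "P ** \<phi> (u + v) ** R = P ** \<phi> u ** R ** (P ** \<phi> v ** R)"
      by (simp add: hom matrix_mul_assoc cancel)
    show "det (P ** \<phi> u ** R) = 1"
      using det by (simp add: det_mul det_1)
    have move: "P ** \<phi> w ** R ** (P ** Q) = P ** Q ** A" if "\<phi> w ** Q = Q ** A" for w Q A
    proof -
      have "P ** \<phi> w ** R ** (P ** Q) = P ** (\<phi> w ** Q)"
        by (simp add: matrix_mul_assoc cancel)
      then show ?thesis
        by (simp add: that matrix_mul_assoc)
    qed
    have det_PQ: "det (P ** Q) \<noteq> 0" if "det Q \<noteq> 0" for Q :: "real^3^3"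
      using that det by (auto simp: det_mul)
    show "\<exists>A Q. standard_generator A \<and> det Q \<noteq> 0 \<and> P ** \<phi> u ** R ** Q = Q ** A" if "u \<noteq> 0"
      using normal_form[OF that] move det_PQ by meson
    show "\<exists>A B Q. standard_generator_pair A B \<and> det Q \<noteq> 0 \<and>
        (P ** \<phi> u ** R ** Q = Q ** A \<and> P ** \<phi> v ** R ** Q = Q ** B \<or>
         P ** \<phi> v ** R ** Q = Q ** A \<and> P ** \<phi> u ** R ** Q = Q ** B)" if "det2 u v \<noteq> 0"
      using normal_form_pair[OF that] move det_PQ by meson
  qed
qed

lemma similar_char_poly_root:
  fixes A J P :: "real^'n^'n"
  assumes "A ** P = P ** J" "det P \<noteq> 0" "det (J - mat c) = 0"
  shows "det (A - mat c) = 0"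
proof -
  have "(A - mat c) ** P = P ** (J - mat c)"
    using assms(1)
    by (simp add: vec_eq_iff matrix_matrix_mult_def mat_def left_diff_distrib right_diff_distrib
        sum_subtractf if_distrib[of "\<lambda>t. t * _"] if_distrib[of "\<lambda>t. _ * t"] cong: if_cong)
  then have "det (A - mat c) * det P = det P * det (J - mat c)"
    by (metis det_mul)
  with assms show ?thesis
    by simp
qed

lemma commuting_positive_in_plane_group:
  fixes \<Gamma> :: "(real^3^3) set"
  assumes comm: "\<And>A B. A \<in> \<Gamma> \<Longrightarrow> B \<in> \<Gamma> \<Longrightarrow> A ** B = B ** A"
    and eig: "\<And>A. A \<in> \<Gamma> \<Longrightarrow> positive_real_eigenvalues A"
    and det: "\<And>A. A \<in> \<Gamma> \<Longrightarrow> det A = 1"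
  obtains \<psi> where "plane_group \<psi>" "\<Gamma> \<subseteq> range \<psi>"
proof -
  obtain P where P: "det P \<noteq> 0"
    and tri: "\<And>A. A \<in> \<Gamma> \<Longrightarrow> \<exists>p q s x y z. A ** P = P ** mat3 p x y 0 q z 0 0 s"
    using simultaneous_triangularization_3[OF comm eig] by metis
  obtain R where R: "P ** R = mat 1" "R ** P = mat 1"
    using P invertible_det_nz[of P] by (auto simp: invertible_def)
  have cancel: "X ** R ** P = X" "X ** P ** R = X" for X :: "real^3^3"
    by (simp_all add: R flip: matrix_mul_assoc)
  define T where "T A = R ** A ** P" for A
  have P_T: "A ** P = P ** T A" for A
    by (simp add: T_def matrix_mul_assoc R)
  have T_entries: "T A = mat3 (T A$1$1) (T A$1$2) (T A$1$3) 0 (T A$2$2) (T A$2$3) 0 0 (T A$3$3)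
      \<and> T A$1$1 > 0 \<and> T A$2$2 > 0 \<and> T A$3$3 > 0 \<and> T A$1$1 * T A$2$2 * T A$3$3 = 1"
    if A: "A \<in> \<Gamma>" for A
  proof -
    obtain p q s x y z where "A ** P = P ** mat3 p x y 0 q z 0 0 s"
      using tri[OF A] by blast
    then have "R ** (A ** P) = R ** (P ** mat3 p x y 0 q z 0 0 s)"
      by simp
    then have T: "T A = mat3 p x y 0 q z 0 0 s"
      by (simp add: T_def matrix_mul_assoc R)
    \<comment> \<open>Diagonal entries of the triangular form are real roots of the characteristic
      polynomial of \<open>A\<close>.\<close>
    have "c > 0" if "c \<in> {p, q, s}" for c
    proof (rule real_root_eigenvalue_pos[OF eig[OF A] similar_char_poly_root[OF P_T P]])
      show "det (T A - mat c) = 0"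
        using that by (auto simp: T det_3 mat_def)
    qed
    moreover have "det P * det (T A) = det P"
      using P_T[of A] det[OF A] by (metis det_mul mult.left_neutral)
    then have "p * q * s = 1"
      using P by (simp add: T det_mat3)
    ultimately show ?thesis
      by (simp add: T)
  qed
  interpret commuting_triangular "T ` \<Gamma>" "\<lambda>A. A$1$1" "\<lambda>A. A$2$2" "\<lambda>A. A$3$3" "\<lambda>A. A$1$2" "\<lambda>A. A$1$3" "\<lambda>A. A$2$3"
  proof
    fix A B assume "A \<in> T ` \<Gamma>" "B \<in> T ` \<Gamma>"
    then obtain A' B' where AB: "A' \<in> \<Gamma>" "B' \<in> \<Gamma>" "A = T A'" "B = T B'"
      by blast
    have "T X ** T Y = R ** (X ** Y) ** P" for X Y
      by (simp add: T_def matrix_mul_assoc) (simp add: cancel flip: matrix_mul_assoc, simp add: matrix_mul_assoc R)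
    then show "A ** B = B ** A"
      using AB comm by metis
  qed (use T_entries in blast)+
  obtain \<phi> Q where \<phi>: "plane_group \<phi>" and Q: "det Q \<noteq> 0"
    and conj: "\<And>A. A \<in> \<Gamma> \<Longrightarrow> \<exists>w. T A ** Q = Q ** \<phi> w"
    using model_group by blast
  have "det (P ** Q) \<noteq> 0"
    using P Q by (simp add: det_mul)
  then obtain U where U: "P ** Q ** U = mat 1"
    using invertible_det_nz[of "P ** Q"] by (auto simp: invertible_def)
  show thesis
  proof (rule that[OF plane_group_conjugate[OF \<phi> U]])
    show "\<Gamma> \<subseteq> range (\<lambda>w. P ** Q ** \<phi> w ** U)"
    proof
      fix A assume "A \<in> \<Gamma>"
      then obtain w where w: "T A ** Q = Q ** \<phi> w"
        using conj by blast
      have "P ** Q ** \<phi> w = A ** (P ** Q)"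
        using P_T[of A] w by (metis matrix_mul_assoc)
      then have "P ** Q ** \<phi> w ** U = A"
        by (simp add: U flip: matrix_mul_assoc) (metis U matrix_mul_assoc matrix_mul_rid)
      then show "A \<in> range (\<lambda>w. P ** Q ** \<phi> w ** U)"
        by blast
    qed
  qed
qed

section \<open>Generators of a discrete subgroup of a model group\<close>

context plane_group
begin

text \<open>The image of 0 is an invertible idempotent.\<close>

lemma map_zero: "\<phi> 0 = mat 1"
proof -
  obtain R where "R ** \<phi> 0 = mat 1"
    using invertible_det_nz[of "\<phi> 0"] det_1[of 0] by (auto simp: invertible_def)
  moreover have "\<phi> 0 = \<phi> 0 ** \<phi> 0"
    using hom[of 0 0] by simp
  ultimately show ?thesis
    by (metis matrix_mul_assoc matrix_mul_lid)
qed

lemma map_uminus: "inv\<^bsub>SL3\<^esub> (\<phi> u) = \<phi> (- u)"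
  using hom[of "- u" u]
  by (intro group.inv_equality[OF group_SL3]) (auto simp: SL3_def det_1 map_zero)

lemma map_add_in:
  assumes "subgroup K SL3" "\<phi> u \<in> K" "\<phi> v \<in> K"
  shows "\<phi> (u + v) \<in> K"
  using subgroup.m_closed[OF assms] by (simp add: hom SL3_def)

lemma map_uminus_in:
  assumes "subgroup K SL3" "\<phi> u \<in> K"
  shows "\<phi> (- u) \<in> K"
  using subgroup.m_inv_closed[OF assms] by (simp add: map_uminus)

lemma map_int_scaleR_in:
  assumes "subgroup K SL3" "\<phi> u \<in> K"
  shows "\<phi> (of_int m *\<^sub>R u) \<in> K"
proof -
  have nat: "\<phi> (of_nat n *\<^sub>R u) \<in> K" for n
  proof (induction n)
    case 0
    show ?case
      using subgroup.one_closed[OF assms(1)] by (simp add: map_zero SL3_def)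
  next
    case (Suc n)
    then show ?case
      using map_add_in[OF assms(1,2)] by (simp add: scaleR_left_distrib)
  qed
  show ?thesis
    using nat map_uminus_in[OF assms(1) nat] by (cases m rule: int_cases2) auto
qed

text \<open>A ball isolating the identity in \<Gamma> pulls back by continuity to a ball around 0,
  and injectivity leaves 0 as the only point of \<open>L\<close> in it. A basis of the lattice
  \<open>L\<close> then maps to generators.\<close>

lemma discrete_subgroup_generated:
  assumes \<Gamma>: "subgroup \<Gamma> SL3" "discrete \<Gamma>" "\<Gamma> \<subseteq> range \<phi>"
  shows "(\<exists>u. \<Gamma> = generate SL3 {\<phi> u}) \<or> (\<exists>u v. det2 u v \<noteq> 0 \<and> \<Gamma> = generate SL3 {\<phi> u, \<phi> v})"
proof -
  define L where "L = \<phi> -` \<Gamma>"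
  have one: "mat 1 \<in> \<Gamma>"
    using subgroup.one_closed[OF \<Gamma>(1)] by (simp add: SL3_def)
  have zero: "0 \<in> L"
    using one by (simp add: L_def map_zero)
  have diff: "u - v \<in> L" if "u \<in> L" "v \<in> L" for u v
    using map_add_in[OF \<Gamma>(1) _ map_uminus_in[OF \<Gamma>(1)], of u v] that by (simp add: L_def)
  obtain e where e: "e > 0" "\<And>A. A \<in> \<Gamma> \<Longrightarrow> dist (mat 1) A < e \<Longrightarrow> A = mat 1"
    using \<Gamma>(2) one unfolding discrete_def isolated_in_dist_Ex_iff by blast
  obtain d where d: "d > 0" "\<And>w. dist w 0 < d \<Longrightarrow> dist (\<phi> w) (\<phi> 0) < e"
    using cont e(1) unfolding continuous_on_iff by (metis UNIV_I)
  have small: "u = 0" if "u \<in> L" "norm u < d" for u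
  proof -
    have "\<phi> u = \<phi> 0"
      using e(2)[of "\<phi> u"] d(2)[of u] that by (simp add: L_def map_zero dist_commute)
    then show ?thesis
      using inj by (simp add: inj_eq)
  qed
  have lattice: "\<Gamma> \<subseteq> K" if "\<And>w. w \<in> L \<Longrightarrow> \<phi> w \<in> K" for K
    using that \<Gamma>(3) by (auto simp: L_def)
  show ?thesis
  proof (rule discrete_plane_subgroup_cases[OF zero diff d(1) small])
    fix u assume u: "u \<in> L" "\<And>w. w \<in> L \<Longrightarrow> \<exists>m::int. w = of_int m *\<^sub>R u"
    have "\<Gamma> = generate SL3 {\<phi> u}"
    proof (rule group.generateI[OF group_SL3 \<Gamma>(1)])
      show "{\<phi> u} \<subseteq> \<Gamma>"
        using u by (simp add: L_def)
      show "\<Gamma> \<subseteq> K" if "subgroup K SL3" "{\<phi> u} \<subseteq> K" for K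
        by (rule lattice) (use u(2) map_int_scaleR_in[OF that(1)] that(2) in blast)
    qed
    then show ?thesis by blast
  next
    fix u v assume uv: "u \<in> L" "v \<in> L" "det2 u v \<noteq> 0"
      "\<And>w. w \<in> L \<Longrightarrow> \<exists>m n::int. w = of_int m *\<^sub>R u + of_int n *\<^sub>R v"
    have "\<Gamma> = generate SL3 {\<phi> u, \<phi> v}"
    proof (rule group.generateI[OF group_SL3 \<Gamma>(1)])
      show "{\<phi> u, \<phi> v} \<subseteq> \<Gamma>"
        using uv by (simp add: L_def)
      show "\<Gamma> \<subseteq> K" if K: "subgroup K SL3" "{\<phi> u, \<phi> v} \<subseteq> K" for K
      proof (rule lattice)
        fix w assume "w \<in> L"
        then obtain m n :: int where "w = of_int m *\<^sub>R u + of_int n *\<^sub>R v"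
          using uv(4) by blast
        then show "\<phi> w \<in> K"
          using map_add_in[OF K(1)] map_int_scaleR_in[OF K(1)] K(2) by simp
      qed
    qed
    with uv(3) show ?thesis by blast
  qed auto
qed

end

section \<open>Conjugacy of generated subgroups\<close>

lemma (in group) conjugate_generate:
  assumes g: "g \<in> carrier G" and S: "S \<subseteq> carrier G"
  shows "g <# (generate G S #> inv g) = generate G ((\<lambda>x. g \<otimes> (x \<otimes> inv g)) ` S)"
proof -
  interpret conj: group_hom G G "\<lambda>x. g \<otimes> (x \<otimes> inv g)"
  proof
    show "(\<lambda>x. g \<otimes> (x \<otimes> inv g)) \<in> hom G G"
    proof (rule homI)
      fix x y assume "x \<in> carrier G" "y \<in> carrier G"
      then show "g \<otimes> (x \<otimes> y \<otimes> inv g) = g \<otimes> (x \<otimes> inv g) \<otimes> (g \<otimes> (y \<otimes> inv g))"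
        using g by (simp add: m_assoc inv_solve_left)
    qed (use g in auto)
  qed
  have "g <# (generate G S #> inv g) = (\<lambda>x. g \<otimes> (x \<otimes> inv g)) ` generate G S"
    by (auto simp: l_coset_def r_coset_def)
  then show ?thesis
    using conj.generate_img[OF S] by simp
qed

text \<open>In odd dimension every real conjugating matrix can be rescaled to determinant one.\<close>

lemma rescale_to_SL3:
  fixes Q :: "real^3^3"
  assumes "det Q \<noteq> 0"
  obtains c where "det (c *\<^sub>R Q) = 1"
proof
  have "det (c *\<^sub>R Q) = c^3 * det Q" for c
    by (simp add: det_3 algebra_simps power3_eq_cube)
  moreover have "root 3 (1 / det Q) ^ 3 = 1 / det Q"
    by (simp add: odd_real_root_pow)
  ultimately show "det (root 3 (1 / det Q) *\<^sub>R Q) = 1"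
    using assms by simp
qed

lemma conjugate_in_generate:
  assumes S: "S \<subseteq> carrier SL3" and Q: "det Q \<noteq> 0"
    and f: "\<And>A. A \<in> S \<Longrightarrow> A ** Q = Q ** f A"
  shows "conjugate_in SL3 (generate SL3 S) (generate SL3 (f ` S))"
proof -
  interpret SL: group SL3 by (rule group_SL3)
  obtain c where c: "det (c *\<^sub>R Q) = 1"
    using rescale_to_SL3[OF Q] .
  let ?R = "c *\<^sub>R Q"
  \<comment> \<open>\<open>conjugate_in\<close> forms g H g^-1, while A R = R f(A) expresses f(A) as
    R^-1 A R; so the conjugator is the inverse of R.\<close>
  let ?g = "inv\<^bsub>SL3\<^esub> ?R"
  have R: "?R \<in> carrier SL3"
    using c by (simp add: SL3_def)
  have gR: "?g ** ?R = mat 1"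
    using SL.l_inv[OF R] by (simp add: SL3_def)
  have "?g \<otimes>\<^bsub>SL3\<^esub> (A \<otimes>\<^bsub>SL3\<^esub> inv\<^bsub>SL3\<^esub> ?g) = f A" if "A \<in> S" for A
  proof -
    have "A ** ?R = ?R ** f A"
      using f[OF that] by (simp add: matrix_scalar_ac flip: scalar_matrix_assoc)
    then have "?g ** (A ** ?R) = f A"
      by (metis gR matrix_mul_assoc matrix_mul_lid)
    moreover have "X \<otimes>\<^bsub>SL3\<^esub> Y = X ** Y" for X Y
      by (simp add: SL3_def)
    ultimately show ?thesis
      by (simp only: SL.inv_inv[OF R])
  qed
  then have "(\<lambda>A. ?g \<otimes>\<^bsub>SL3\<^esub> (A \<otimes>\<^bsub>SL3\<^esub> inv\<^bsub>SL3\<^esub> ?g)) ` S = f ` S"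
    by simp
  then show ?thesis
    unfolding conjugate_in_def using SL.conjugate_generate[OF SL.inv_closed[OF R] S] SL.inv_closed[OF R]
    by metis
qed

text \<open>Cyclicity and two-generation are equalities of group records inside \<Gamma>; this
  translates them into generation of a set within \<open>SL3\<close>.\<close>

lemma subgroup_generated_eq_iff:
  assumes "subgroup \<Gamma> SL3" "S \<subseteq> \<Gamma>"
  shows "subgroup_generated (SL3\<lparr>carrier := \<Gamma>\<rparr>) S = SL3\<lparr>carrier := \<Gamma>\<rparr> \<longleftrightarrow> generate SL3 S = \<Gamma>"
proof -
  have "subgroup_generated (SL3\<lparr>carrier := \<Gamma>\<rparr>) S = SL3\<lparr>carrier := generate SL3 S\<rparr>"
    using assms group.generate_consistent[OF group_SL3 assms(2,1)]
    by (simp add: subgroup_generated_def Int_absorb1)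
  then show ?thesis
    by (metis partial_object.select_convs(1) partial_object.update_convs(1) partial_object.surjective)
qed

text \<open>The trivial group is cyclic, but no listed single generator is the identity, so the
  normal form for cyclic groups is asserted for nontrivial ones.\<close>

theorem proposition6p1:
  fixes \<Gamma> :: "(real^3^3) set"
  assumes "subgroup \<Gamma> SL3"
    and "discrete \<Gamma>"
    and "comm_group (SL3\<lparr>carrier := \<Gamma>\<rparr>)"
    and "\<forall>\<gamma>\<in>\<Gamma>. positive_real_eigenvalues \<gamma>"
  shows "(cyclic_group (SL3\<lparr>carrier := \<Gamma>\<rparr>) \<or> two_generated_group (SL3\<lparr>carrier := \<Gamma>\<rparr>))
    \<and> (cyclic_group (SL3\<lparr>carrier := \<Gamma>\<rparr>) \<and> \<Gamma> \<noteq> {\<one>\<^bsub>SL3\<^esub>} \<longrightarrow>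
         (\<exists>A. standard_generator A \<and> conjugate_in SL3 \<Gamma> (generate SL3 {A})))
    \<and> (two_generated_group (SL3\<lparr>carrier := \<Gamma>\<rparr>) \<longrightarrow>
         (\<exists>A B. standard_generator_pair A B \<and> conjugate_in SL3 \<Gamma> (generate SL3 {A, B})))"
proof -
  let ?G = "SL3\<lparr>carrier := \<Gamma>\<rparr>"
  have carrier: "\<Gamma> \<subseteq> carrier SL3"
    using assms(1) by (rule subgroup.subset)
  obtain \<psi> where "plane_group \<psi>" and range: "\<Gamma> \<subseteq> range \<psi>"
  proof (rule commuting_positive_in_plane_group[of \<Gamma>])
    show "A ** B = B ** A" if "A \<in> \<Gamma>" "B \<in> \<Gamma>" for A B
      using comm_monoid.m_comm[OF comm_group.axioms(1)[OF assms(3)], of A B] that by (simp add: SL3_def)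
    show "det A = 1" if "A \<in> \<Gamma>" for A
      using that carrier by (auto simp: SL3_def)
  qed (use assms(4) in auto)
  then interpret plane_group \<psi> by simp
  have cyc: "cyclic_group ?G \<longleftrightarrow> (\<exists>a\<in>\<Gamma>. generate SL3 {a} = \<Gamma>)"
    using subgroup_generated_eq_iff[OF assms(1)] by (auto simp: cyclic_group_def)
  have two: "two_generated_group ?G \<longleftrightarrow> (\<exists>a\<in>\<Gamma>. \<exists>b\<in>\<Gamma>. generate SL3 {a, b} = \<Gamma>) \<and> \<not> cyclic_group ?G"
    using subgroup_generated_eq_iff[OF assms(1)] by (auto simp: two_generated_group_def)
  have independent: "\<exists>u v. det2 u v \<noteq> 0 \<and> \<Gamma> = generate SL3 {\<psi> u, \<psi> v}" if "\<not> cyclic_group ?G"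
    using discrete_subgroup_generated[OF assms(1,2) range] that generate.incl[of _ "{_}" SL3] cyc by (metis singletonI)
  show ?thesis
  proof (intro conjI impI)
    show "cyclic_group ?G \<or> two_generated_group ?G"
      using independent generate.incl[of _ "{_, _}" SL3] unfolding two by (metis insertCI)
  next
    assume "cyclic_group ?G \<and> \<Gamma> \<noteq> {\<one>\<^bsub>SL3\<^esub>}"
    then obtain u where u: "\<psi> u \<in> \<Gamma>" "\<Gamma> = generate SL3 {\<psi> u}" "\<Gamma> \<noteq> {\<one>\<^bsub>SL3\<^esub>}"
      using range cyc by blast
    have "u \<noteq> 0"
    proof
      assume "u = 0"
      then have "\<Gamma> = {\<one>\<^bsub>SL3\<^esub>}"
        using u(2) group.generate_one[OF group_SL3] by (simp add: map_zero SL3_def)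
      with u(3) show False ..
    qed
    then obtain A Q where "standard_generator A" "det Q \<noteq> 0" "\<psi> u ** Q = Q ** A"
      using normal_form by blast
    then show "\<exists>A. standard_generator A \<and> conjugate_in SL3 \<Gamma> (generate SL3 {A})"
      using conjugate_in_generate[of "{\<psi> u}" Q "\<lambda>_. A"] u(1) carrier by (auto simp flip: u(2))
  next
    assume "two_generated_group ?G"
    \<comment> \<open>The given two generators are replaced by a lattice basis, whose independence
      comes from \<Gamma> not being cyclic.\<close>
    then obtain u v where uv: "det2 u v \<noteq> 0" "\<Gamma> = generate SL3 {\<psi> u, \<psi> v}"
      using independent two by blast
    have conj: "conjugate_in SL3 \<Gamma> (generate SL3 {A, B})"
      if "{a, b} = {\<psi> u, \<psi> v}" "a \<noteq> b" "det Q \<noteq> 0" "a ** Q = Q ** A" "b ** Q = Q ** B" for a b A B Q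
    proof -
      have "{a, b} \<subseteq> carrier SL3"
        unfolding that(1) by (simp add: SL3_def det_1)
      then have "conjugate_in SL3 (generate SL3 {a, b})
          (generate SL3 ((\<lambda>x. if x = a then A else B) ` {a, b}))"
        by (rule conjugate_in_generate[OF _ that(3)]) (use that in auto)
      moreover have "(\<lambda>x. if x = a then A else B) ` {a, b} = {A, B}"
        using that(2) by auto
      ultimately show ?thesis
        by (simp only: uv(2) that(1))
    qed
    have "\<psi> u \<noteq> \<psi> v"
      using uv(1) inj by (auto simp: inj_eq det2_def)
    moreover obtain A B Q where "standard_generator_pair A B" "det Q \<noteq> 0"
      "\<psi> u ** Q = Q ** A \<and> \<psi> v ** Q = Q ** B \<or> \<psi> v ** Q = Q ** A \<and> \<psi> u ** Q = Q ** B"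
      using normal_form_pair[OF uv(1)] by blast
    ultimately have "conjugate_in SL3 \<Gamma> (generate SL3 {A, B})"
      using conj[of "\<psi> u" "\<psi> v" Q A B] conj[of "\<psi> v" "\<psi> u" Q A B] by (auto simp: insert_commute)
    then show "\<exists>A B. standard_generator_pair A B \<and> conjugate_in SL3 \<Gamma> (generate SL3 {A, B})"
      using \<open>standard_generator_pair A B\<close> by blast
  qed
qed

end
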